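(* Assume that the generalized $\beta$-conformal change $L\mapsto\overline L=f(e^{\sigma}L,\beta)$ is projective and that $L$ is Minkowskian. Then the Weyl torsion tensor $\overline W^h_{ij}$ and the Douglas tensor $\overline D^h_{ijk}$ of $(M,\overline L)$ vanish. Consequently, $(M,L)$ with $\dim M>2$ is projectively flat.
   Context: $(M,L)$ is an $n$-dimensional smooth Finsler manifold with canonical spray $G^i$ (geodesics: $\frac{dy^i}{dt}+2G^i=wy^i$, $y^i=dx^i/dt$, for some function $w$); $\dot\partial_i=\partial/\partial y^i$. $L$ is Minkowskian if around each point there are coordinates in which $L$ depends only on $y$; then the Berwald h-curvature and hv-curvature vanish. A Finsler space is projectively flat if around each point there are coordinates in which its geodesics are straight lines. A generalized $\beta$-conformal change is $L\mapsto\overline{L}=f(\widetilde L,\beta)$ with $\widetilde L=e^{\sigma(x)}L$, $\sigma$ a smooth function on $M$, $\beta=b_i(x)y^i$ a 1-form, and $f$ smooth and positively homogeneous of degree one in $(\widetilde L,\beta)$; it is assumed that $(M,\overline L)$ is a Finsler space, and that $m_i:=b_i-(\beta/L^2)y_i\ne0$ (with $y_i=g_{ij}y^j$) at the points under consideration. The change is projective if $(M,L)$ and $(M,\overline L)$ have the same geodesics up to parametrization. The Douglas tensor is $D^h_{ijk}=\dot\partial_i\dot\partial_j\dot\partial_k\left(G^h-\frac{1}{n+1}\,y^h\,\dot\partial_mG^m\right)$. The Weyl torsion tensor $W^h_{ij}$ is the standard projective Weyl torsion tensor built from the h-curvature of the Berwald connection: with $R^h_k$ the Riemann curvature (Jacobi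 endomorphism) of the spray and $R=\frac{1}{n-1}R^m_m$, put $W^h_k=R^h_k-R\delta^h_k-\frac{1}{n+1}y^h\,\dot\partial_m(R^m_k-R\delta^m_k)$ and $W^h_{ij}=\frac13(\dot\partial_jW^h_i-\dot\partial_iW^h_j)$ (up to sign convention). Barred tensors are those of $(M,\overline L)$. *)

theory Defs
  imports "HOL-Analysis.Analysis"
begin

subsection \<open>Smooth maps on open subsets of normed spaces\<close>

fun Ck_on :: "nat \<Rightarrow> 'a::real_normed_vector set \<Rightarrow> ('a \<Rightarrow> 'b::real_normed_vector) \<Rightarrow> bool" where
  "Ck_on 0 S f \<longleftrightarrow> continuous_on S f"
| "Ck_on (Suc k) S f \<longleftrightarrow>
     (\<forall>x\<in>S. f differentiable (at x)) \<and> (\<forall>v. Ck_on k S (\<lambda>x. frechet_derivative f (at x) v))"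

text \<open>Only used for open \<open>S\<close>.\<close>
definition smooth_on :: "'a::real_normed_vector set \<Rightarrow> ('a \<Rightarrow> 'b::real_normed_vector) \<Rightarrow> bool" where
  "smooth_on S f \<longleftrightarrow> (\<forall>k. Ck_on k S f)"

subsection \<open>Smooth manifolds and tangent vectors\<close>

text \<open>The manifold is a whole type \<open>'m\<close> (Hausdorff and second countable by its type class), its
  dimension is \<open>CARD('n)\<close>, and its smooth structure is a maximal atlas. A chart is a pair
  \<open>(U, \<phi>)\<close>; the values of \<open>\<phi>\<close> outside \<open>U\<close> are irrelevant.\<close>

type_synonym ('m, 'n) chart = "'m set \<times> ('m \<Rightarrow> real^'n)"

definition chart_dom :: "('m, 'n) chart \<Rightarrow> 'm set" where
  "chart_dom c = fst c"

definition chart_map :: "('m, 'n) chart \<Rightarrow> 'm \<Rightarrow> real^'n" where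
  "chart_map c = snd c"

definition chart_img :: "('m, 'n) chart \<Rightarrow> (real^'n) set" where
  "chart_img c = chart_map c ` chart_dom c"

definition chart_inv :: "('m, 'n) chart \<Rightarrow> real^'n \<Rightarrow> 'm" where
  "chart_inv c = inv_into (chart_dom c) (chart_map c)"

definition is_chart :: "('m::topological_space, 'n::finite) chart \<Rightarrow> bool" where
  "is_chart c \<longleftrightarrow> open (chart_dom c) \<and> open (chart_img c) \<and>
     homeomorphism (chart_dom c) (chart_img c) (chart_map c) (chart_inv c)"

definition smooth_transition :: "('m, 'n::finite) chart \<Rightarrow> ('m, 'n) chart \<Rightarrow> bool" where
  "smooth_transition c d \<longleftrightarrow>
     smooth_on (chart_map c ` (chart_dom c \<inter> chart_dom d)) (chart_map d \<circ> chart_inv c)"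

definition smooth_manifold ::
    "('m::{t2_space, second_countable_topology}, 'n::finite) chart set \<Rightarrow> bool" where
  "smooth_manifold A \<longleftrightarrow>
     (\<forall>c\<in>A. is_chart c) \<and> (\<Union>c\<in>A. chart_dom c) = UNIV \<and>
     (\<forall>c\<in>A. \<forall>d\<in>A. smooth_transition c d) \<and>
     (\<forall>d. is_chart d \<and> (\<forall>c\<in>A. smooth_transition c d \<and> smooth_transition d c) \<longrightarrow> d \<in> A)"

definition smooth_function :: "('m, 'n::finite) chart set \<Rightarrow> ('m \<Rightarrow> real) \<Rightarrow> bool" where
  "smooth_function A f \<longleftrightarrow> (\<forall>c\<in>A. smooth_on (chart_img c) (f \<circ> chart_inv c))"

text \<open>Tangent vectors are derivations of the algebra of smooth functions (set to 0 on functions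
  that are not smooth, so that a derivation does not depend on the chart used to write it).
  \<open>tangent_vector A c x y\<close> is \<open>y\<^sup>i \<partial>/\<partial>x\<^sup>i\<close> at the point with coordinates \<open>x\<close> in the chart \<open>c\<close>.\<close>

type_synonym 'm tangent = "('m \<Rightarrow> real) \<Rightarrow> real"

definition tangent_vector ::
    "('m, 'n::finite) chart set \<Rightarrow> ('m, 'n) chart \<Rightarrow> real^'n \<Rightarrow> real^'n \<Rightarrow> 'm tangent" where
  "tangent_vector A c x y =
     (\<lambda>f. if smooth_function A f then frechet_derivative (f \<circ> chart_inv c) (at x) y else 0)"

text \<open>A function on the tangent bundle takes a base point and a tangent vector at it.
  Its coordinate expression is a function of \<open>(x, y)\<close>.\<close>

definition coord_expr ::
    "('m, 'n::finite) chart set \<Rightarrow> ('m, 'n) chart \<Rightarrow> ('m \<Rightarrow> 'm tangent \<Rightarrow> real) \<Rightarrow>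
     (real^'n) \<times> (real^'n) \<Rightarrow> real" where
  "coord_expr A c L = (\<lambda>(x, y). L (chart_inv c x) (tangent_vector A c x y))"

definition one_form :: "('m, 'n::finite) chart set \<Rightarrow> ('m \<Rightarrow> 'm tangent \<Rightarrow> real) \<Rightarrow> bool" where
  "one_form A \<beta> \<longleftrightarrow> (\<forall>c\<in>A. \<exists>b :: real^'n \<Rightarrow> real^'n. smooth_on (chart_img c) b \<and>
     (\<forall>x\<in>chart_img c. \<forall>y. coord_expr A c \<beta> (x, y) = (\<Sum>i\<in>UNIV. b x $ i * y $ i)))"

subsection \<open>Coordinate tensors of a Finsler function\<close>

text \<open>In this part \<open>F\<close> is the coordinate expression of a Finsler function in some chart.\<close>

definition pd_x :: "'n::finite \<Rightarrow> ((real^'n) \<times> (real^'n) \<Rightarrow> real) \<Rightarrow> (real^'n) \<times> (real^'n) \<Rightarrow> real" where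
  "pd_x i F z = frechet_derivative F (at z) (axis i 1, 0)"

definition pd_y :: "'n::finite \<Rightarrow> ((real^'n) \<times> (real^'n) \<Rightarrow> real) \<Rightarrow> (real^'n) \<times> (real^'n) \<Rightarrow> real" where
  "pd_y i F z = frechet_derivative F (at z) (0, axis i 1)"

definition metric_tensor ::
    "((real^'n::finite) \<times> (real^'n) \<Rightarrow> real) \<Rightarrow> (real^'n) \<times> (real^'n) \<Rightarrow> real^'n^'n" where
  "metric_tensor F z = (\<chi> i j. pd_y i (pd_y j (\<lambda>w. (F w)\<^sup>2)) z / 2)"

text \<open>\<open>G\<^sup>i = 1/4 g\<^sup>i\<^sup>l (y\<^sup>k \<partial>\<^sub>k \<partial>'\<^sub>l F\<^sup>2 - \<partial>\<^sub>l F\<^sup>2)\<close> with \<open>\<partial>'\<close> the derivatives in \<open>y\<close>.\<close>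
definition spray ::
    "((real^'n::finite) \<times> (real^'n) \<Rightarrow> real) \<Rightarrow> 'n \<Rightarrow> (real^'n) \<times> (real^'n) \<Rightarrow> real" where
  "spray F i z = (1 / 4) * (\<Sum>l\<in>UNIV. matrix_inv (metric_tensor F z) $ i $ l *
     ((\<Sum>k\<in>UNIV. snd z $ k * pd_x k (pd_y l (\<lambda>w. (F w)\<^sup>2)) z) - pd_x l (\<lambda>w. (F w)\<^sup>2) z))"

definition douglas ::
    "((real^'n::finite) \<times> (real^'n) \<Rightarrow> real) \<Rightarrow> 'n \<Rightarrow> 'n \<Rightarrow> 'n \<Rightarrow> 'n \<Rightarrow> (real^'n) \<times> (real^'n) \<Rightarrow> real" where
  "douglas F h i j k = pd_y i (pd_y j (pd_y k
     (\<lambda>z. spray F h z - snd z $ h * (\<Sum>m\<in>UNIV. pd_y m (spray F m) z) / (real CARD('n) + 1))))"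

text \<open>The Jacobi endomorphism
  \<open>R\<^sup>h\<^sub>k = 2 \<partial>\<^sub>k G\<^sup>h - y\<^sup>j \<partial>\<^sub>j \<partial>'\<^sub>k G\<^sup>h + 2 G\<^sup>j \<partial>'\<^sub>j \<partial>'\<^sub>k G\<^sup>h - \<partial>'\<^sub>j G\<^sup>h \<partial>'\<^sub>k G\<^sup>j\<close>.\<close>
definition riemann ::
    "((real^'n::finite) \<times> (real^'n) \<Rightarrow> real) \<Rightarrow> 'n \<Rightarrow> 'n \<Rightarrow> (real^'n) \<times> (real^'n) \<Rightarrow> real" where
  "riemann F h k z =
     2 * pd_x k (spray F h) z
     - (\<Sum>j\<in>UNIV. snd z $ j * pd_x j (pd_y k (spray F h)) z)
     + 2 * (\<Sum>j\<in>UNIV. spray F j z * pd_y j (pd_y k (spray F h)) z)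
     - (\<Sum>j\<in>UNIV. pd_y j (spray F h) z * pd_y k (spray F j) z)"

definition riemann_trace ::
    "((real^'n::finite) \<times> (real^'n) \<Rightarrow> real) \<Rightarrow> (real^'n) \<times> (real^'n) \<Rightarrow> real" where
  "riemann_trace F z = (\<Sum>m\<in>UNIV. riemann F m m z) / (real CARD('n) - 1)"

text \<open>\<open>R\<^sup>h\<^sub>k - R \<delta>\<^sup>h\<^sub>k\<close>\<close>
definition riemann_reduced ::
    "((real^'n::finite) \<times> (real^'n) \<Rightarrow> real) \<Rightarrow> 'n \<Rightarrow> 'n \<Rightarrow> (real^'n) \<times> (real^'n) \<Rightarrow> real" where
  "riemann_reduced F h k z = riemann F h k z - (if h = k then riemann_trace F z else 0)"

definition weyl_deviation ::
    "((real^'n::finite) \<times> (real^'n) \<Rightarrow> real) \<Rightarrow> 'n \<Rightarrow> 'n \<Rightarrow> (real^'n) \<times> (real^'n) \<Rightarrow> real" where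
  "weyl_deviation F h k z = riemann_reduced F h k z
     - snd z $ h * (\<Sum>m\<in>UNIV. pd_y m (riemann_reduced F m k) z) / (real CARD('n) + 1)"

definition weyl_torsion ::
    "((real^'n::finite) \<times> (real^'n) \<Rightarrow> real) \<Rightarrow> 'n \<Rightarrow> 'n \<Rightarrow> 'n \<Rightarrow> (real^'n) \<times> (real^'n) \<Rightarrow> real" where
  "weyl_torsion F h i j z =
     (pd_y j (weyl_deviation F h i) z - pd_y i (weyl_deviation F h j) z) / 3"

text \<open>\<open>m\<^sub>i = b\<^sub>i - (\<beta>/F\<^sup>2) y\<^sub>i\<close> with \<open>y\<^sub>i = g\<^sub>i\<^sub>j y\<^sup>j\<close>; \<open>B\<close> is the coordinate expression of
  \<open>\<beta>\<close>, so that \<open>b\<^sub>i(x) = B(x, e\<^sub>i)\<close>.\<close>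
definition m_covector ::
    "((real^'n::finite) \<times> (real^'n) \<Rightarrow> real) \<Rightarrow> ((real^'n) \<times> (real^'n) \<Rightarrow> real) \<Rightarrow>
     (real^'n) \<times> (real^'n) \<Rightarrow> real^'n" where
  "m_covector F B z =
     (\<chi> i. B (fst z, axis i 1)) - (B z / (F z)\<^sup>2) *\<^sub>R (metric_tensor F z *v snd z)"

subsection \<open>Finsler spaces\<close>

definition finsler_space ::
    "('m, 'n::finite) chart set \<Rightarrow> ('m \<Rightarrow> 'm tangent \<Rightarrow> real) \<Rightarrow> bool" where
  "finsler_space A L \<longleftrightarrow> (\<forall>c\<in>A.
     smooth_on (chart_img c \<times> (- {0})) (coord_expr A c L) \<and>
     (\<forall>x\<in>chart_img c.
        (\<forall>y. y \<noteq> 0 \<longrightarrow> coord_expr A c L (x, y) > 0) \<and>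
        (\<forall>y r. r > 0 \<longrightarrow> coord_expr A c L (x, r *\<^sub>R y) = r * coord_expr A c L (x, y)) \<and>
        (\<forall>y v. y \<noteq> 0 \<longrightarrow> v \<noteq> 0 \<longrightarrow> v \<bullet> (metric_tensor (coord_expr A c L) (x, y) *v v) > 0)))"

definition minkowskian ::
    "('m, 'n::finite) chart set \<Rightarrow> ('m \<Rightarrow> 'm tangent \<Rightarrow> real) \<Rightarrow> bool" where
  "minkowskian A L \<longleftrightarrow> (\<forall>p. \<exists>c\<in>A. p \<in> chart_dom c \<and>
     (\<exists>H :: real^'n \<Rightarrow> real. \<forall>x\<in>chart_img c. \<forall>y. coord_expr A c L (x, y) = H y))"

text \<open>The parametrization of a curve is arbitrary, only required to be smooth and regular.\<close>
definition regular_curve ::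
    "('m::topological_space, 'n::finite) chart set \<Rightarrow> real set \<Rightarrow> (real \<Rightarrow> 'm) \<Rightarrow> bool" where
  "regular_curve A I \<gamma> \<longleftrightarrow> open I \<and> is_interval I \<and> continuous_on I \<gamma> \<and>
     (\<forall>c\<in>A. smooth_on {t\<in>I. \<gamma> t \<in> chart_dom c} (chart_map c \<circ> \<gamma>) \<and>
        (\<forall>t\<in>I. \<gamma> t \<in> chart_dom c \<longrightarrow> vector_derivative (chart_map c \<circ> \<gamma>) (at t) \<noteq> 0))"

definition geodesic ::
    "('m::topological_space, 'n::finite) chart set \<Rightarrow> ('m \<Rightarrow> 'm tangent \<Rightarrow> real) \<Rightarrow>
     real set \<Rightarrow> (real \<Rightarrow> 'm) \<Rightarrow> bool" where
  "geodesic A L I \<gamma> \<longleftrightarrow> regular_curve A I \<gamma> \<and>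
     (\<exists>w :: real \<Rightarrow> real. \<forall>c\<in>A. \<forall>t\<in>I. \<gamma> t \<in> chart_dom c \<longrightarrow>
        (let x = chart_map c \<circ> \<gamma>;
             y = (\<lambda>s. vector_derivative x (at s))
         in vector_derivative y (at t) + 2 *\<^sub>R (\<chi> i. spray (coord_expr A c L) i (x t, y t))
            = w t *\<^sub>R y t))"

text \<open>Since \<open>w\<close> is arbitrary, the class of geodesics is already invariant under
  reparametrization; equality of these classes is equality up to parametrization.\<close>
definition projectively_related ::
    "('m::topological_space, 'n::finite) chart set \<Rightarrow> ('m \<Rightarrow> 'm tangent \<Rightarrow> real) \<Rightarrow>
     ('m \<Rightarrow> 'm tangent \<Rightarrow> real) \<Rightarrow> bool" where
  "projectively_related A L L' \<longleftrightarrow> (\<forall>I \<gamma>. geodesic A L I \<gamma> \<longleftrightarrow> geodesic A L' I \<gamma>)"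

definition projectively_flat ::
    "('m::topological_space, 'n::finite) chart set \<Rightarrow> ('m \<Rightarrow> 'm tangent \<Rightarrow> real) \<Rightarrow> bool" where
  "projectively_flat A L \<longleftrightarrow> (\<forall>p. \<exists>c\<in>A. p \<in> chart_dom c \<and>
     (\<forall>I \<gamma>. regular_curve A I \<gamma> \<and> \<gamma> ` I \<subseteq> chart_dom c \<longrightarrow>
        (geodesic A L I \<gamma> \<longleftrightarrow> collinear ((chart_map c \<circ> \<gamma>) ` I))))"

text \<open>\<open>L' = f(e\<^sup>\<sigma> L, \<beta>)\<close> away from the zero section, with \<open>f\<close> smooth and positively homogeneous
  of degree one on an open cone \<open>C\<close> containing all the values of \<open>(e\<^sup>\<sigma> L, \<beta>)\<close>. For instance
  \<open>f(u, v) = u\<^sup>2/(u - v)\<close> is not defined everywhere.\<close>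
definition gen_beta_conformal_change ::
    "('m, 'n::finite) chart set \<Rightarrow> ('m \<Rightarrow> real) \<Rightarrow> ('m \<Rightarrow> 'm tangent \<Rightarrow> real) \<Rightarrow>
     (real \<times> real) set \<Rightarrow> (real \<times> real \<Rightarrow> real) \<Rightarrow>
     ('m \<Rightarrow> 'm tangent \<Rightarrow> real) \<Rightarrow> ('m \<Rightarrow> 'm tangent \<Rightarrow> real) \<Rightarrow> bool" where
  "gen_beta_conformal_change A \<sigma> \<beta> C f L L' \<longleftrightarrow>
     smooth_function A \<sigma> \<and> one_form A \<beta> \<and>
     open C \<and> smooth_on C f \<and>
     (\<forall>u v r. (u, v) \<in> C \<longrightarrow> r > 0 \<longrightarrow> (r * u, r * v) \<in> C \<and> f (r * u, r * v) = r * f (u, v)) \<and>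
     (\<forall>c\<in>A. \<forall>x\<in>chart_img c. \<forall>y. y \<noteq> 0 \<longrightarrow>
        (let u = exp (\<sigma> (chart_inv c x)) * coord_expr A c L (x, y);
             v = coord_expr A c \<beta> (x, y)
         in (u, v) \<in> C \<and> coord_expr A c L' (x, y) = f (u, v)))"

end

theory Submission
  imports Defs
begin

text \<open>Write \<open>y\<close> for the fibre coordinate, \<open>G\<close> for the spray coefficients of \<open>L\<close> and \<open>G'\<close> for those of
\<open>Lbar\<close>. The idea is that both curvature tensors are projective invariants, and that \<open>L\<close> has the
geodesics of a flat linear connection.

In Minkowski coordinates the spray of \<open>L\<close> is zero. Let \<open>\<psi>\<close> be the transition from an arbitrary chart
to Minkowski coordinates. Then in the arbitrary chart \<open>G(x, y) = 1/2 \<Gamma>\<^sub>x(y, y)\<close>, where \<open>\<Gamma>\<close> is the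
connection that \<open>\<psi>\<close> pulls back from the trivial one, \<open>D\<psi> \<Gamma>(u, v) = D\<^sup>2\<psi>(u, v)\<close>; it is symmetric and flat
because second and third derivatives of \<open>\<psi>\<close> are symmetric (\<open>spray_eq_quadratic\<close>,
\<open>flat_connection\<close>). The same \<open>\<Gamma>\<close> governs the change of the acceleration of a curve under \<open>\<psi>\<close>
(\<open>acceleration_change\<close>), so a curve is a geodesic of \<open>L\<close> iff its acceleration in Minkowski
coordinates is proportional to its velocity, which means that it runs on a straight line
(\<open>geodesic_iff_collinear\<close>). This is the projective flatness of \<open>L\<close>.

Through every \<open>(x, y)\<close> there is thus an explicit geodesic of \<open>L\<close>, a straight line in Minkowski
coordinates. It is a geodesic of \<open>Lbar\<close> too, and comparing the two geodesic equations at that point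
gives \<open>G' = G + P y\<close> (\<open>projective_spray_difference\<close>). The function \<open>P\<close> is smooth and homogeneous of
degree 1 in \<open>y\<close>, since the sprays are smooth and homogeneous of degree 2.

It remains to see that such a spray has vanishing Douglas and Weyl tensors. By Euler's theorem
\<open>P y\<close> contributes exactly \<open>(n + 1) P\<close> to the trace \<open>\<partial>'\<^sub>m G'\<^sup>m\<close>, so \<open>P\<close> drops out of the function that is
differentiated in the Douglas tensor; what is left is quadratic in \<open>y\<close> and has no third derivatives
(\<open>douglas_eq_0\<close>). The Jacobi endomorphism changes by \<open>R(G + P y) u = R(G) u + \<Xi> u + \<tau>(u) y\<close>
(\<open>jacobi_projective\<close>), and \<open>R(G) = 0\<close> by flatness. As \<open>\<tau>(y) = - \<Xi>\<close> and \<open>\<tau>\<close> is homogeneous of degree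
1, subtracting the trace removes \<open>\<Xi>\<close> and the divergence term of the Weyl deviation removes \<open>\<tau>\<close>
(\<open>weyl_torsion_eq_0_if_isotropic\<close>).\<close>

section \<open>Calculus of smooth maps\<close>

abbreviation D :: "('a::real_normed_vector \<Rightarrow> 'b::real_normed_vector) \<Rightarrow> 'a \<Rightarrow> 'a \<Rightarrow> 'b" where
  "D f z \<equiv> frechet_derivative f (at z)"

lemma D_eqI: "(f has_derivative f') (at z) \<Longrightarrow> D f z = f'"
  by (metis frechet_derivative_at)

lemma Ck_on_imp_continuous_on: "Ck_on k S f \<Longrightarrow> continuous_on S f"
  by (cases k) (auto intro!: continuous_at_imp_continuous_on differentiable_imp_continuous_within)

lemma Ck_on_Suc_imp: "Ck_on (Suc k) S f \<Longrightarrow> Ck_on k S f"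
proof (induction k arbitrary: f)
  case 0
  then show ?case using Ck_on_imp_continuous_on[OF 0] by simp
next
  case (Suc k)
  then show ?case by (metis Ck_on.simps(2))
qed

lemma Ck_on_subset: "Ck_on k S f \<Longrightarrow> T \<subseteq> S \<Longrightarrow> Ck_on k T f"
  by (induction k arbitrary: f) (auto intro: continuous_on_subset)

lemma Ck_on_cong:
  assumes "open S" "\<And>x. x \<in> S \<Longrightarrow> f x = g x" "Ck_on k S f"
  shows "Ck_on k S g"
  using assms(2,3)
proof (induction k arbitrary: f g)
  case 0
  then show ?case by (metis Ck_on.simps(1) continuous_on_eq)
next
  case (Suc k)
  have *: "(g has_derivative D f x) (at x)" if "x \<in> S" for x
    using Suc.prems that assms(1)
    by (meson Ck_on.simps(2) frechet_derivative_works has_derivative_transform_within_open)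
  then have "D g x = D f x" if "x \<in> S" for x
    using D_eqI that by blast
  then have "Ck_on k S (\<lambda>x. D g x v)" for v
    using Suc.IH[of "\<lambda>x. D f x v" "\<lambda>x. D g x v"] Suc.prems by simp
  then show ?case using * differentiableI by (auto simp: differentiable_def)
qed

lemma Ck_on_const: "Ck_on k S (\<lambda>x. c)"
  by (induction k arbitrary: c) auto

lemma Ck_on_bounded_linear:
  assumes h: "bounded_linear h" shows "Ck_on k S f \<Longrightarrow> open S \<Longrightarrow> Ck_on k S (\<lambda>x. h (f x))"
proof (induction k arbitrary: f)
  case 0
  then show ?case using bounded_linear.continuous_on[OF h] by simp
next
  case (Suc k)
  have d: "((\<lambda>x. h (f x)) has_derivative (\<lambda>v. h (D f x v))) (at x)" if "x \<in> S" for x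
    using Suc.prems that
    by (intro bounded_linear.has_derivative[OF h]) (auto simp: frechet_derivative_works)
  have "Ck_on k S (\<lambda>x. D (\<lambda>x. h (f x)) x v)" for v
    by (rule Ck_on_cong[OF Suc.prems(2) _ Suc.IH[of "\<lambda>x. D f x v"]])
       (use Suc.prems D_eqI[OF d] in auto)
  then show ?case using d by (auto simp: differentiable_def)
qed

lemma Ck_on_add: "Ck_on k S f \<Longrightarrow> Ck_on k S g \<Longrightarrow> open S \<Longrightarrow> Ck_on k S (\<lambda>x. f x + g x)"
proof (induction k arbitrary: f g)
  case 0
  then show ?case by (auto intro: continuous_intros)
next
  case (Suc k)
  have d: "((\<lambda>x. f x + g x) has_derivative (\<lambda>v. D f x v + D g x v)) (at x)" if "x \<in> S" for x
    using Suc.prems that by (intro has_derivative_add) (auto simp: frechet_derivative_works)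
  have "Ck_on k S (\<lambda>x. D (\<lambda>x. f x + g x) x v)" for v
    by (rule Ck_on_cong[OF Suc.prems(3) _ Suc.IH[of "\<lambda>x. D f x v" "\<lambda>x. D g x v"]])
       (use Suc.prems D_eqI[OF d] in auto)
  then show ?case using d by (auto simp: differentiable_def)
qed

lemma Ck_on_bounded_bilinear:
  assumes h: "bounded_bilinear h"
  shows "Ck_on k S f \<Longrightarrow> Ck_on k S g \<Longrightarrow> open S \<Longrightarrow> Ck_on k S (\<lambda>x. h (f x) (g x))"
proof (induction k arbitrary: f g)
  case 0
  then show ?case using bounded_bilinear.continuous_on[OF h] by simp
next
  case (Suc k)
  have d: "((\<lambda>x. h (f x) (g x)) has_derivative (\<lambda>v. h (f x) (D g x v) + h (D f x v) (g x))) (at x)"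
    if "x \<in> S" for x
    using Suc.prems that
    by (intro bounded_bilinear.FDERIV[OF h]) (auto simp: frechet_derivative_works)
  have "Ck_on k S (\<lambda>x. D (\<lambda>x. h (f x) (g x)) x v)" for v
    by (rule Ck_on_cong[OF Suc.prems(3) _ Ck_on_add[OF
          Suc.IH[of f "\<lambda>x. D g x v"] Suc.IH[of "\<lambda>x. D f x v" g]]])
       (use Suc.prems Ck_on_Suc_imp D_eqI[OF d] in auto)
  then show ?case using d by (auto simp: differentiable_def)
qed

lemma Ck_on_sum:
  "(\<And>i. i \<in> I \<Longrightarrow> Ck_on k S (f i)) \<Longrightarrow> open S \<Longrightarrow> Ck_on k S (\<lambda>x. \<Sum>i\<in>I. f i x)"
  by (induction I rule: infinite_finite_induct) (auto intro: Ck_on_add Ck_on_const)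

lemma linear_euclidean_expansion:
  fixes A :: "'a::euclidean_space \<Rightarrow> 'b::real_vector"
  assumes "linear A" shows "A u = (\<Sum>b\<in>Basis. (u \<bullet> b) *\<^sub>R A b)"
proof -
  have "A u = A (\<Sum>b\<in>Basis. (u \<bullet> b) *\<^sub>R b)" by (simp add: euclidean_representation)
  then show ?thesis by (simp add: linear_sum[OF assms] linear_scale[OF assms])
qed

text \<open>Expanding the derivative of \<open>g\<close> at \<open>f x\<close> in a basis of the middle space turns the chain rule into sums
of products of functions to which the induction hypothesis applies; this is why the middle space
is finite-dimensional.\<close>
lemma Ck_on_compose:
  fixes f :: "'a::real_normed_vector \<Rightarrow> 'b::euclidean_space" and g :: "'b \<Rightarrow> 'c::real_normed_vector"
  shows "Ck_on k S f \<Longrightarrow> Ck_on k T g \<Longrightarrow> f ` S \<subseteq> T \<Longrightarrow> open S \<Longrightarrow> Ck_on k S (\<lambda>x. g (f x))"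
proof (induction k arbitrary: g)
  case 0
  then show ?case using continuous_on_compose2 by (metis Ck_on.simps(1))
next
  case (Suc k)
  have g: "g differentiable (at (f x))" if "x \<in> S" for x using that Suc.prems by auto
  have d: "((\<lambda>x. g (f x)) has_derivative (\<lambda>v. D g (f x) (D f x v))) (at x)" if "x \<in> S" for x
    using Suc.prems g[OF that] that
    by (intro has_derivative_compose[of f _ _ _ g]) (auto simp: frechet_derivative_works)
  have "Ck_on k S (\<lambda>x. D (\<lambda>x. g (f x)) x v)" for v
  proof (rule Ck_on_cong[OF Suc.prems(4)])
    fix x assume x: "x \<in> S"
    show "(\<Sum>b\<in>Basis. (D f x v \<bullet> b) *\<^sub>R D g (f x) b) = D (\<lambda>x. g (f x)) x v"
      unfolding fun_cong[OF D_eqI[OF d[OF x]]]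
      by (rule linear_euclidean_expansion[OF linear_frechet_derivative[OF g[OF x]], symmetric])
  next
    show "Ck_on k S (\<lambda>x. \<Sum>b\<in>Basis. (D f x v \<bullet> b) *\<^sub>R D g (f x) b)"
    proof (intro Ck_on_sum Ck_on_bounded_bilinear[OF bounded_bilinear_scaleR] Suc.prems)
      fix b :: 'b
      show "Ck_on k S (\<lambda>x. D f x v \<bullet> b)"
        using Ck_on_bounded_linear[OF bounded_linear_inner_left, of k S "\<lambda>x. D f x v" b]
          Suc.prems by auto
      show "Ck_on k S (\<lambda>x. D g (f x) b)"
        using Suc.IH[of "\<lambda>y. D g y b"] Suc.prems Ck_on_Suc_imp[OF Suc.prems(1)] by auto
    qed
  qed
  then show ?case using d by (auto simp: differentiable_def)
qed

lemma Ck_on_inverse: "Ck_on k (-{0}) (inverse :: real \<Rightarrow> real)"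
proof (induction k)
  case 0
  then show ?case by (auto intro!: continuous_intros)
next
  case (Suc k)
  have d: "(inverse has_derivative (\<lambda>v. - (inverse x * v * inverse x))) (at x)" if "x \<in> -{0}" for x :: real
    using that by (intro has_derivative_inverse') auto
  have "Ck_on k (-{0}) (\<lambda>x. D (inverse :: real \<Rightarrow> real) x v)" for v
  proof (rule Ck_on_cong)
    show "Ck_on k (-{0}) (\<lambda>x. (-v) * (inverse x * inverse x))"
      by (intro Ck_on_bounded_bilinear[OF bounded_bilinear_mult] Suc Ck_on_const) auto
  qed (use D_eqI[OF d] in auto)
  then show ?case using d by (auto simp: differentiable_def)
qed

lemma smooth_on_D: "smooth_on S f \<Longrightarrow> smooth_on S (\<lambda>x. D f x v)"
  unfolding smooth_on_def by (metis Ck_on.simps(2))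

lemma smooth_on_has_derivative: "smooth_on S f \<Longrightarrow> x \<in> S \<Longrightarrow> (f has_derivative D f x) (at x)"
  unfolding smooth_on_def by (metis Ck_on.simps(2) frechet_derivative_works)

lemma smooth_on_differentiable: "smooth_on S f \<Longrightarrow> x \<in> S \<Longrightarrow> f differentiable (at x)"
  using smooth_on_has_derivative differentiable_def by blast

lemma smooth_on_continuous_on: "smooth_on S f \<Longrightarrow> continuous_on S f"
  unfolding smooth_on_def using Ck_on_imp_continuous_on by blast

lemma smooth_on_bounded_linear_D: "smooth_on S f \<Longrightarrow> x \<in> S \<Longrightarrow> bounded_linear (D f x)"
  using smooth_on_has_derivative has_derivative_bounded_linear by blast

lemma smooth_on_linear_D: "smooth_on S f \<Longrightarrow> x \<in> S \<Longrightarrow> linear (D f x)"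
  using smooth_on_bounded_linear_D bounded_linear.linear by blast

text \<open>\<open>frechet_derivative\<close> chooses among the derivatives of a function, and functions that agree near a
point have the same derivatives there, possibly none.\<close>
lemma D_cong:
  assumes "open S" "x \<in> S" "\<And>x. x \<in> S \<Longrightarrow> f x = g x" shows "D f x = D g x"
proof -
  have "(f has_derivative f') (at x) \<longleftrightarrow> (g has_derivative f') (at x)" for f'
    using has_derivative_transform_within_open[OF _ assms(1,2), of f f' UNIV g]
      has_derivative_transform_within_open[OF _ assms(1,2), of g f' UNIV f] assms(3) by metis
  then show ?thesis by (simp add: frechet_derivative_def)
qed

lemma smooth_on_cong: "open S \<Longrightarrow> (\<And>x. x \<in> S \<Longrightarrow> f x = g x) \<Longrightarrow> smooth_on S f \<Longrightarrow> smooth_on S g"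
  unfolding smooth_on_def using Ck_on_cong by blast

lemma smooth_on_subset: "smooth_on S f \<Longrightarrow> T \<subseteq> S \<Longrightarrow> smooth_on T f"
  unfolding smooth_on_def using Ck_on_subset by blast

lemma smooth_on_const: "smooth_on S (\<lambda>x. c)"
  unfolding smooth_on_def using Ck_on_const by blast

lemma smooth_on_bounded_linear: "bounded_linear h \<Longrightarrow> smooth_on S f \<Longrightarrow> open S \<Longrightarrow> smooth_on S (\<lambda>x. h (f x))"
  unfolding smooth_on_def using Ck_on_bounded_linear by blast

lemma smooth_on_id: "open S \<Longrightarrow> smooth_on S (\<lambda>x. x)"
proof -
  have "Ck_on k S (\<lambda>x. x)" for k
    by (cases k) (auto intro: Ck_on_const)
  then show ?thesis by (simp add: smooth_on_def)
qed

lemma smooth_on_add: "smooth_on S f \<Longrightarrow> smooth_on S g \<Longrightarrow> open S \<Longrightarrow> smooth_on S (\<lambda>x. f x + g x)"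
  unfolding smooth_on_def using Ck_on_add by blast

lemma smooth_on_bounded_bilinear:
  "bounded_bilinear h \<Longrightarrow> smooth_on S f \<Longrightarrow> smooth_on S g \<Longrightarrow> open S \<Longrightarrow> smooth_on S (\<lambda>x. h (f x) (g x))"
  unfolding smooth_on_def using Ck_on_bounded_bilinear by blast

lemmas smooth_on_mult = smooth_on_bounded_bilinear[OF bounded_bilinear_mult]
lemmas smooth_on_scaleR = smooth_on_bounded_bilinear[OF bounded_bilinear_scaleR]
lemmas smooth_on_inner = smooth_on_bounded_bilinear[OF bounded_bilinear_inner]

lemma smooth_on_uminus: "smooth_on S f \<Longrightarrow> open S \<Longrightarrow> smooth_on S (\<lambda>x. - f x)"
  by (rule smooth_on_bounded_linear[OF bounded_linear_minus[OF bounded_linear_ident]])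

lemma smooth_on_diff: "smooth_on S f \<Longrightarrow> smooth_on S g \<Longrightarrow> open S \<Longrightarrow> smooth_on S (\<lambda>x. f x - g x)"
  using smooth_on_add[of S f "\<lambda>x. - g x"] smooth_on_uminus by auto

lemma smooth_on_sum:
  "(\<And>i. i \<in> I \<Longrightarrow> smooth_on S (f i)) \<Longrightarrow> open S \<Longrightarrow> smooth_on S (\<lambda>x. \<Sum>i\<in>I. f i x)"
  by (simp add: Ck_on_sum smooth_on_def)

lemma smooth_on_prod:
  fixes f :: "'i \<Rightarrow> 'a::real_normed_vector \<Rightarrow> real"
  shows "(\<And>i. i \<in> I \<Longrightarrow> smooth_on S (f i)) \<Longrightarrow> open S \<Longrightarrow> smooth_on S (\<lambda>x. \<Prod>i\<in>I. f i x)"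
  by (induction I rule: infinite_finite_induct) (auto intro: smooth_on_mult smooth_on_const)

lemma smooth_on_compose:
  fixes f :: "'a::real_normed_vector \<Rightarrow> 'b::euclidean_space" and g :: "'b \<Rightarrow> 'c::real_normed_vector"
  shows "smooth_on S f \<Longrightarrow> smooth_on T g \<Longrightarrow> f ` S \<subseteq> T \<Longrightarrow> open S \<Longrightarrow> smooth_on S (\<lambda>x. g (f x))"
  unfolding smooth_on_def using Ck_on_compose by blast

lemma smooth_on_inverse:
  fixes f :: "'a::real_normed_vector \<Rightarrow> real"
  assumes "smooth_on S f" "\<And>x. x \<in> S \<Longrightarrow> f x \<noteq> 0" "open S"
  shows "smooth_on S (\<lambda>x. inverse (f x))"
  by (rule smooth_on_compose[OF assms(1), of "-{0}"])
     (use assms Ck_on_inverse in \<open>auto simp: smooth_on_def\<close>)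

lemma smooth_on_divide:
  fixes f g :: "'a::real_normed_vector \<Rightarrow> real"
  assumes "smooth_on S f" "smooth_on S g" "\<And>x. x \<in> S \<Longrightarrow> g x \<noteq> 0" "open S"
  shows "smooth_on S (\<lambda>x. f x / g x)"
  unfolding divide_inverse by (intro smooth_on_mult smooth_on_inverse assms)

lemma smooth_on_fst: "smooth_on S f \<Longrightarrow> open S \<Longrightarrow> smooth_on S (\<lambda>x. fst (f x))"
  by (rule smooth_on_bounded_linear[OF bounded_linear_fst])

lemma smooth_on_snd: "smooth_on S f \<Longrightarrow> open S \<Longrightarrow> smooth_on S (\<lambda>x. snd (f x))"
  by (rule smooth_on_bounded_linear[OF bounded_linear_snd])

lemma smooth_on_nth: "smooth_on S f \<Longrightarrow> open S \<Longrightarrow> smooth_on S (\<lambda>x. f x $ i)"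
  by (rule smooth_on_bounded_linear[OF bounded_linear_vec_nth])

lemma smooth_on_Pair:
  assumes "smooth_on S f" "smooth_on S g" "open S" shows "smooth_on S (\<lambda>x. (f x, g x))"
proof -
  have "smooth_on S (\<lambda>x. (f x, 0) + (0, g x))"
    by (intro smooth_on_add smooth_on_bounded_linear[of "\<lambda>u. (u, 0)"]
          smooth_on_bounded_linear[of "\<lambda>u. (0, u)"] assms bounded_linear_Pair
          bounded_linear_ident bounded_linear_zero)
  then show ?thesis by simp
qed

lemma smooth_on_vec:
  fixes f :: "'i::finite \<Rightarrow> 'a::real_normed_vector \<Rightarrow> real"
  assumes "\<And>i. smooth_on S (f i)" "open S" shows "smooth_on S (\<lambda>x. \<chi> i. f i x)"
proof -
  have "smooth_on S (\<lambda>x. \<Sum>i\<in>UNIV. f i x *\<^sub>R axis i (1::real))"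
    by (intro smooth_on_sum smooth_on_scaleR smooth_on_const assms)
  also have "(\<lambda>x. \<Sum>i\<in>UNIV. f i x *\<^sub>R axis i (1::real)) = (\<lambda>x. \<chi> i. f i x)"
    by (auto simp: vec_eq_iff axis_def if_distrib cong: if_cong)
  finally show ?thesis .
qed

text \<open>Families \<open>A\<^sub>z\<close> of linear maps, with \<open>A\<^sub>z u\<close> smooth in \<open>z\<close> for each fixed \<open>u\<close>, cover both the differential
\<open>u \<mapsto> D f z u\<close> and the slots of a connection. They are used instead of maps into a space of operators.\<close>
lemma smooth_on_linear_family:
  fixes A :: "'a::real_normed_vector \<Rightarrow> 'b::euclidean_space \<Rightarrow> 'c::real_normed_vector"
  assumes A: "\<And>u. smooth_on S (\<lambda>z. A z u)" "\<And>z. z \<in> S \<Longrightarrow> linear (A z)"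
    and k: "smooth_on S k" and S: "open S"
  shows "smooth_on S (\<lambda>z. A z (k z))"
proof (rule smooth_on_cong[OF S])
  show "(\<Sum>b\<in>Basis. (k z \<bullet> b) *\<^sub>R A z b) = A z (k z)" if "z \<in> S" for z
    by (rule linear_euclidean_expansion[OF A(2)[OF that], symmetric])
  show "smooth_on S (\<lambda>z. \<Sum>b\<in>Basis. (k z \<bullet> b) *\<^sub>R A z b)"
    by (intro smooth_on_sum smooth_on_scaleR smooth_on_inner smooth_on_const A k S)
qed

text \<open>The second difference over a parallelogram is symmetric in \<open>u\<close> and \<open>v\<close>, and by two applications of
the mean value theorem it is \<open>h\<^sup>2\<close> times a mixed second derivative at a nearby point. Letting the parallelogram
shrink gives the symmetry of second derivatives.\<close>
lemma second_difference_mvt: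
  fixes f :: "'a::real_normed_vector \<Rightarrow> real"
  assumes f: "smooth_on S f" and h: "h > 0"
    and S: "\<And>s t. 0 \<le> s \<Longrightarrow> s \<le> h \<Longrightarrow> 0 \<le> t \<Longrightarrow> t \<le> h \<Longrightarrow> x + s *\<^sub>R u + t *\<^sub>R v \<in> S"
  shows "\<exists>s t. 0 < s \<and> s < h \<and> 0 < t \<and> t < h \<and>
    f (x + h *\<^sub>R u + h *\<^sub>R v) - f (x + h *\<^sub>R u) - f (x + h *\<^sub>R v) + f x
      = h * h * D (\<lambda>z. D f z u) (x + s *\<^sub>R u + t *\<^sub>R v) v"
proof -
  have line: "((\<lambda>s. F (p + s *\<^sub>R w)) has_real_derivative D F (p + s *\<^sub>R w) w) (at s)"
    if "smooth_on S F" "p + s *\<^sub>R w \<in> S" for F :: "'a \<Rightarrow> real" and p w s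
  proof -
    have "((\<lambda>s. F (p + s *\<^sub>R w)) has_derivative (\<lambda>r. D F (p + s *\<^sub>R w) (r *\<^sub>R w))) (at s)"
      by (rule has_derivative_compose[where f="\<lambda>s. p + s *\<^sub>R w" and g=F, OF _ smooth_on_has_derivative[OF that]])
         (auto intro!: derivative_eq_intros)
    moreover have "(\<lambda>r. D F (p + s *\<^sub>R w) (r *\<^sub>R w)) = (*) (D F (p + s *\<^sub>R w) w)"
      using linear_scale[OF smooth_on_linear_D[OF that]] by (auto simp: mult.commute)
    ultimately show ?thesis by (simp add: has_field_derivative_def)
  qed
  define \<phi> where "\<phi> s = f ((x + h *\<^sub>R v) + s *\<^sub>R u) - f (x + s *\<^sub>R u)" for s
  have "\<exists>s. 0 < s \<and> s < h \<and> \<phi> h - \<phi> 0 = (h - 0) * (D f ((x + h *\<^sub>R v) + s *\<^sub>R u) u - D f (x + s *\<^sub>R u) u)"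
    unfolding \<phi>_def using S[of _ h] S[of _ 0] h
    by (intro MVT2 DERIV_diff line[OF f]) (auto simp: algebra_simps)
  then obtain s where s: "0 < s" "s < h"
    "\<phi> h - \<phi> 0 = h * (D f ((x + h *\<^sub>R v) + s *\<^sub>R u) u - D f (x + s *\<^sub>R u) u)" by auto
  have "\<exists>t. 0 < t \<and> t < h \<and> D f ((x + s *\<^sub>R u) + h *\<^sub>R v) u - D f ((x + s *\<^sub>R u) + 0 *\<^sub>R v) u =
      (h - 0) * D (\<lambda>z. D f z u) ((x + s *\<^sub>R u) + t *\<^sub>R v) v"
    using S[of s] s h by (intro MVT2 line[OF smooth_on_D[OF f]]) auto
  then obtain t where "0 < t" "t < h" "D f ((x + s *\<^sub>R u) + h *\<^sub>R v) u - D f (x + s *\<^sub>R u) u =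
      h * D (\<lambda>z. D f z u) ((x + s *\<^sub>R u) + t *\<^sub>R v) v" by auto
  then show ?thesis using s
    by (intro exI[of _ s] exI[of _ t]) (auto simp: \<phi>_def algebra_simps)
qed

lemma D_D_commute_real:
  fixes f :: "'a::real_normed_vector \<Rightarrow> real"
  assumes f: "smooth_on S f" and S: "open S" "x \<in> S"
  shows "D (\<lambda>z. D f z u) x v = D (\<lambda>z. D f z v) x u"
proof -
  have "\<bar>D (\<lambda>z. D f z u) x v - D (\<lambda>z. D f z v) x u\<bar> \<le> e" if e: "e > 0" for e
  proof -
    have cont: "isCont (\<lambda>y. D (\<lambda>z. D f z p) y q) x" for p q
      using smooth_on_continuous_on[OF smooth_on_D[OF smooth_on_D[OF f]]] S
      by (simp add: continuous_on_eq_continuous_at)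
    obtain d1 where d1: "d1 > 0" "\<And>y. dist y x < d1 \<Longrightarrow>
        \<bar>D (\<lambda>z. D f z u) y v - D (\<lambda>z. D f z u) x v\<bar> < e / 2"
      using cont[of u v, unfolded continuous_at_eps_delta, rule_format, of "e/2"] e
      by (auto simp: dist_real_def)
    obtain d2 where d2: "d2 > 0" "\<And>y. dist y x < d2 \<Longrightarrow>
        \<bar>D (\<lambda>z. D f z v) y u - D (\<lambda>z. D f z v) x u\<bar> < e / 2"
      using cont[of v u, unfolded continuous_at_eps_delta, rule_format, of "e/2"] e
      by (auto simp: dist_real_def)
    obtain d3 where d3: "d3 > 0" "\<And>y. dist y x < d3 \<Longrightarrow> y \<in> S"
      using S open_dist by metis
    define d where "d = min d1 (min d2 d3)"
    define N where "N = norm u + norm v + 1"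
    \<comment> \<open>Small enough for the parallelogram with sides \<open>h u\<close>, \<open>h v\<close> to lie within distance \<open>d\<close> of \<open>x\<close>.\<close>
    define h where "h = d / (2 * N)"
    have n: "N > 0" by (simp add: N_def add_nonneg_pos)
    have d: "d > 0" using d1 d2 d3 by (simp add: d_def)
    have h: "h > 0" using d n by (simp add: h_def)
    have close: "dist (x + s *\<^sub>R u + t *\<^sub>R v) x < d" if "0 \<le> s" "s \<le> h" "0 \<le> t" "t \<le> h" for s t
    proof -
      have "norm (s *\<^sub>R u + t *\<^sub>R v) \<le> s * norm u + t * norm v"
        using norm_triangle_ineq[of "s *\<^sub>R u" "t *\<^sub>R v"] that by simp
      also have "\<dots> \<le> h * norm u + h * norm v" using that by (intro add_mono mult_right_mono) auto
      also have "\<dots> \<le> h * N" using h by (simp add: N_def algebra_simps)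
      also have "\<dots> = d / 2" using n by (simp add: h_def)
      also have "\<dots> < d" using d by simp
      finally show ?thesis by (simp add: dist_norm algebra_simps)
    qed
    have inS: "x + s *\<^sub>R u + t *\<^sub>R v \<in> S" "x + s *\<^sub>R v + t *\<^sub>R u \<in> S"
      if "0 \<le> s" "s \<le> h" "0 \<le> t" "t \<le> h" for s t
      using close[of s t] close[of t s] that d3(2)[of "x + s *\<^sub>R u + t *\<^sub>R v"]
        d3(2)[of "x + s *\<^sub>R v + t *\<^sub>R u"] by (simp_all add: d_def add_ac)
    obtain s t where st: "0 < s" "s < h" "0 < t" "t < h"
      "f (x + h *\<^sub>R u + h *\<^sub>R v) - f (x + h *\<^sub>R u) - f (x + h *\<^sub>R v) + f x
      = h * h * D (\<lambda>z. D f z u) (x + s *\<^sub>R u + t *\<^sub>R v) v"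
      using second_difference_mvt[OF f h inS(1)] by blast
    obtain s' t' where st': "0 < s'" "s' < h" "0 < t'" "t' < h"
      "f (x + h *\<^sub>R v + h *\<^sub>R u) - f (x + h *\<^sub>R v) - f (x + h *\<^sub>R u) + f x
      = h * h * D (\<lambda>z. D f z v) (x + s' *\<^sub>R v + t' *\<^sub>R u) u"
      using second_difference_mvt[OF f h inS(2)] by blast
    have "h * h * D (\<lambda>z. D f z u) (x + s *\<^sub>R u + t *\<^sub>R v) v
        = h * h * D (\<lambda>z. D f z v) (x + s' *\<^sub>R v + t' *\<^sub>R u) u"
      unfolding st(5)[symmetric] st'(5)[symmetric] by (simp add: add_ac)
    then have "D (\<lambda>z. D f z u) (x + s *\<^sub>R u + t *\<^sub>R v) v = D (\<lambda>z. D f z v) (x + t' *\<^sub>R u + s' *\<^sub>R v) u"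
      using h by (simp add: add_ac)
    moreover have "dist (x + s *\<^sub>R u + t *\<^sub>R v) x < d1" "dist (x + t' *\<^sub>R u + s' *\<^sub>R v) x < d2"
      using close[of s t] close[of t' s'] st st' by (auto simp: d_def)
    ultimately show ?thesis using d1(2)[of "x + s *\<^sub>R u + t *\<^sub>R v"] d2(2)[of "x + t' *\<^sub>R u + s' *\<^sub>R v"]
      by argo
  qed
  then have "\<bar>D (\<lambda>z. D f z u) x v - D (\<lambda>z. D f z v) x u\<bar> \<le> 0"
    by (meson dense_ge)
  then show ?thesis by simp
qed

lemma D_bounded_linear:
  assumes "bounded_linear h" "smooth_on S f" "x \<in> S"
  shows "D (\<lambda>z. h (f z)) x v = h (D f x v)"
  using D_eqI[OF bounded_linear.has_derivative[OF assms(1) smooth_on_has_derivative[OF assms(2,3)]]]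
  by simp

lemma D_D_commute:
  fixes f :: "'a::real_normed_vector \<Rightarrow> 'b::euclidean_space"
  assumes f: "smooth_on S f" and S: "open S" "x \<in> S"
  shows "D (\<lambda>z. D f z u) x v = D (\<lambda>z. D f z v) x u"
proof (rule euclidean_eqI)
  fix b :: 'b
  note inner = bounded_linear_inner_left[of b]
  have fb: "smooth_on S (\<lambda>z. f z \<bullet> b)" using smooth_on_bounded_linear[OF inner f S(1)] .
  have *: "D (\<lambda>z. D f z p) x q \<bullet> b = D (\<lambda>z. D (\<lambda>z. f z \<bullet> b) z p) x q" for p q
  proof -
    have "D (\<lambda>z. D f z p) x q \<bullet> b = D (\<lambda>z. D f z p \<bullet> b) x q"
      using D_bounded_linear[OF inner smooth_on_D[OF f] S(2)] by simp
    also have "D (\<lambda>z. D f z p \<bullet> b) x = D (\<lambda>z. D (\<lambda>z. f z \<bullet> b) z p) x"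
      by (rule D_cong[OF S])
         (simp add: D_bounded_linear[OF inner f])
    finally show ?thesis .
  qed
  show "D (\<lambda>z. D f z u) x v \<bullet> b = D (\<lambda>z. D f z v) x u \<bullet> b"
    unfolding * by (rule D_D_commute_real[OF fb S])
qed

lemma D_bounded_bilinear:
  assumes "bounded_bilinear h" "smooth_on S f" "smooth_on S g" "x \<in> S"
  shows "D (\<lambda>z. h (f z) (g z)) x v = h (f x) (D g x v) + h (D f x v) (g x)"
  using D_eqI[OF bounded_bilinear.FDERIV[OF assms(1) smooth_on_has_derivative[OF assms(2,4)]
      smooth_on_has_derivative[OF assms(3,4)]]] by simp

lemmas D_scaleR = D_bounded_bilinear[OF bounded_bilinear_scaleR]
lemmas D_mult = D_bounded_bilinear[OF bounded_bilinear_mult]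

lemma D_add:
  assumes "smooth_on S f" "smooth_on S g" "x \<in> S"
  shows "D (\<lambda>z. f z + g z) x v = D f x v + D g x v"
  using D_eqI[OF has_derivative_add[OF smooth_on_has_derivative[OF assms(1,3)]
      smooth_on_has_derivative[OF assms(2,3)]]] by simp

lemma D_compose:
  assumes "smooth_on S f" "x \<in> S" "smooth_on T g" "f x \<in> T"
  shows "D (\<lambda>z. g (f z)) x v = D g (f x) (D f x v)"
  using D_eqI[OF has_derivative_compose[OF smooth_on_has_derivative[OF assms(1,2)]
      smooth_on_has_derivative[OF assms(3,4)]]] by simp

lemma D_linear:
  assumes "bounded_linear h" shows "D h x v = h v"
  using D_eqI[OF bounded_linear_imp_has_derivative[OF assms]] by simp

text \<open>The product rule for evaluating a smooth family of linear maps at a smooth argument.\<close>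
lemma D_linear_family:
  fixes A :: "'a::real_normed_vector \<Rightarrow> 'b::euclidean_space \<Rightarrow> 'c::real_normed_vector"
  assumes A: "\<And>u. smooth_on S (\<lambda>z. A z u)" "\<And>z. z \<in> S \<Longrightarrow> linear (A z)"
    and k: "smooth_on S k" and S: "open S" "x \<in> S"
  shows "D (\<lambda>z. A z (k z)) x v = D (\<lambda>z. A z (k x)) x v + A x (D k x v)"
proof -
  have expand: "A z u = (\<Sum>b\<in>Basis. (u \<bullet> b) *\<^sub>R A z b)" if "z \<in> S" for z u
    using linear_euclidean_expansion[OF A(2)[OF that]] .
  have kb: "smooth_on S (\<lambda>z. k z \<bullet> b)" for b
    by (rule smooth_on_bounded_linear[OF bounded_linear_inner_left k S(1)])
  have D_sum: "D (\<lambda>z. \<Sum>b\<in>Basis. F b z) x v = (\<Sum>b\<in>Basis. D (F b) x v)"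
    if "\<And>b. smooth_on S (F b)" for F :: "'b \<Rightarrow> 'a \<Rightarrow> 'c"
    using fun_cong[OF D_eqI[OF has_derivative_sum[of Basis F "\<lambda>b. D (F b) x" "at x",
            OF smooth_on_has_derivative[OF that S(2)]]], of v] .
  have "D (\<lambda>z. A z (k z)) x v = D (\<lambda>z. \<Sum>b\<in>Basis. (k z \<bullet> b) *\<^sub>R A z b) x v"
    by (rule arg_cong[of _ _ "\<lambda>F. F v"], rule D_cong[OF S expand])
  also have "\<dots> = (\<Sum>b\<in>Basis. (k x \<bullet> b) *\<^sub>R D (\<lambda>z. A z b) x v + (D k x v \<bullet> b) *\<^sub>R A x b)"
    using smooth_on_scaleR[OF kb A(1) S(1)]
    by (simp add: D_sum D_scaleR[OF kb A(1) S(2)]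
        D_bounded_linear[OF bounded_linear_inner_left k S(2)])
  also have "\<dots> = (\<Sum>b\<in>Basis. (k x \<bullet> b) *\<^sub>R D (\<lambda>z. A z b) x v) + A x (D k x v)"
    using expand[OF S(2), of "D k x v"] by (simp add: sum.distrib)
  also have "(\<Sum>b\<in>Basis. (k x \<bullet> b) *\<^sub>R D (\<lambda>z. A z b) x v)
      = D (\<lambda>z. \<Sum>b\<in>Basis. (k x \<bullet> b) *\<^sub>R A z b) x v"
    using D_sum[of "\<lambda>b z. (k x \<bullet> b) *\<^sub>R A z b"] smooth_on_scaleR[OF smooth_on_const A(1) S(1)]
    by (simp add: D_scaleR[OF smooth_on_const A(1) S(2)])
  also have "D (\<lambda>z. \<Sum>b\<in>Basis. (k x \<bullet> b) *\<^sub>R A z b) x = D (\<lambda>z. A z (k x)) x"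
    by (rule D_cong[OF S expand[symmetric]])
  finally show ?thesis .
qed

section \<open>Homogeneity in the fibre variable\<close>

definition homogeneous_on ::
    "nat \<Rightarrow> (real^'n) set \<Rightarrow> ((real^'n) \<times> (real^'n) \<Rightarrow> 'b::real_vector) \<Rightarrow> bool" where
  "homogeneous_on k U F \<longleftrightarrow>
     (\<forall>x\<in>U. \<forall>y r. y \<noteq> 0 \<longrightarrow> r > 0 \<longrightarrow> F (x, r *\<^sub>R y) = r ^ k *\<^sub>R F (x, y))"

lemma homogeneous_onD:
  "homogeneous_on k U F \<Longrightarrow> x \<in> U \<Longrightarrow> y \<noteq> 0 \<Longrightarrow> r > 0 \<Longrightarrow> F (x, r *\<^sub>R y) = r ^ k *\<^sub>R F (x, y)"
  by (simp add: homogeneous_on_def)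

lemma open_slit: "open U \<Longrightarrow> open (U \<times> (- {0 :: 'a::real_normed_vector}))"
  by (intro open_Times) auto

text \<open>Differentiate \<open>F (x, r y) = r\<^sup>k F (x, y)\<close>. The degree \<open>k - 1\<close> of a fibre derivative appears as the
factor \<open>r\<close> in the argument \<open>r v\<close>, which avoids negative degrees.\<close>
lemma D_homogeneous:
  fixes F :: "(real^'n) \<times> (real^'n) \<Rightarrow> 'b::real_normed_vector"
  assumes F: "smooth_on (U \<times> -{0}) F" "homogeneous_on k U F"
    and U: "open U" "x \<in> U" "y \<noteq> 0" "r > 0"
  shows "D F (x, r *\<^sub>R y) (u, r *\<^sub>R v) = r ^ k *\<^sub>R D F (x, y) (u, v)"
proof -
  let ?m = "\<lambda>z :: (real^'n) \<times> (real^'n). (fst z, r *\<^sub>R snd z)"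
  have m: "bounded_linear ?m"
    by (intro bounded_linear_Pair bounded_linear_fst
        bounded_linear_compose[OF bounded_linear_scaleR_right bounded_linear_snd])
  have "((\<lambda>z. F (?m z)) has_derivative (\<lambda>w. D F (?m (x, y)) (?m w))) (at (x, y))"
    by (rule has_derivative_compose[OF bounded_linear_imp_has_derivative[OF m]
          smooth_on_has_derivative[OF F(1)]]) (use U in auto)
  moreover have "((\<lambda>z. F (?m z)) has_derivative (\<lambda>w. r ^ k *\<^sub>R D F (x, y) w)) (at (x, y))"
  proof (rule has_derivative_transform_within_open[OF _ open_slit[OF U(1)]])
    show "((\<lambda>z. r ^ k *\<^sub>R F z) has_derivative (\<lambda>w. r ^ k *\<^sub>R D F (x, y) w)) (at (x, y))"
      by (rule bounded_linear.has_derivative[OF bounded_linear_scaleR_right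
            smooth_on_has_derivative[OF F(1)]]) (use U in auto)
    fix z :: "(real^'n) \<times> (real^'n)" assume "z \<in> U \<times> - {0}"
    then obtain a b where "z = (a, b)" "a \<in> U" "b \<noteq> 0" by auto
    then show "r ^ k *\<^sub>R F z = F (?m z)"
      using homogeneous_onD[OF F(2), of a b r] U by simp
  qed (use U in auto)
  ultimately have "(\<lambda>w. D F (?m (x, y)) (?m w)) = (\<lambda>w. r ^ k *\<^sub>R D F (x, y) w)"
    by (rule has_derivative_unique)
  from fun_cong[OF this, of "(u, v)"] show ?thesis by simp
qed

lemma homogeneous_on_Dx:
  fixes F :: "(real^'n) \<times> (real^'n) \<Rightarrow> 'b::real_normed_vector"
  assumes "smooth_on (U \<times> -{0}) F" "homogeneous_on k U F" "open U"
  shows "homogeneous_on k U (\<lambda>z. D F z (u, 0))"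
  using D_homogeneous[OF assms, of _ _ _ u 0] by (simp add: homogeneous_on_def)

lemma homogeneous_on_Dy:
  fixes F :: "(real^'n) \<times> (real^'n) \<Rightarrow> 'b::real_normed_vector"
  assumes "smooth_on (U \<times> -{0}) F" "homogeneous_on (Suc k) U F" "open U"
  shows "homogeneous_on k U (\<lambda>z. D F z (0, v))"
  unfolding homogeneous_on_def
proof (intro ballI allI impI)
  fix x y :: "real^'n" and r :: real assume z: "x \<in> U" "y \<noteq> 0" "r > 0"
  have "linear (D F (x, r *\<^sub>R y))"
    using z by (intro smooth_on_linear_D[OF assms(1)]) auto
  then have "r *\<^sub>R D F (x, r *\<^sub>R y) (0, v) = D F (x, r *\<^sub>R y) (0, r *\<^sub>R v)"
    by (simp flip: linear_scale)
  also have "\<dots> = r *\<^sub>R (r ^ k *\<^sub>R D F (x, y) (0, v))"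
    using D_homogeneous[OF assms z, of 0 v] by simp
  finally show "D F (x, r *\<^sub>R y) (0, v) = r ^ k *\<^sub>R D F (x, y) (0, v)"
    using z by (simp del: scaleR_scaleR)
qed

text \<open>Euler's theorem: differentiate \<open>F (x, t y) = t\<^sup>k F (x, y)\<close> in \<open>t\<close> at \<open>t = 1\<close>.\<close>
lemma euler_homogeneous:
  fixes F :: "(real^'n) \<times> (real^'n) \<Rightarrow> 'b::real_normed_vector"
  assumes F: "smooth_on (U \<times> -{0}) F" "homogeneous_on k U F" and z: "x \<in> U" "y \<noteq> 0"
  shows "D F (x, y) (0, y) = real k *\<^sub>R F (x, y)"
proof -
  have xy: "(x, 1 *\<^sub>R y) \<in> U \<times> -{0}" using z by simp
  have "((\<lambda>t. (x, t *\<^sub>R y)) has_derivative (\<lambda>t. (0, t *\<^sub>R y))) (at 1)"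
    by (auto intro!: derivative_eq_intros)
  from has_derivative_compose[OF this smooth_on_has_derivative[OF F(1) xy]]
  have "((\<lambda>t. F (x, t *\<^sub>R y)) has_derivative (\<lambda>t. D F (x, y) (0, t *\<^sub>R y))) (at 1)" by simp
  moreover have "((\<lambda>t. F (x, t *\<^sub>R y)) has_derivative (\<lambda>t. (real k * t) *\<^sub>R F (x, y))) (at 1)"
  proof (rule has_derivative_transform_within_open[of "\<lambda>t. t ^ k *\<^sub>R F (x, y)" _ _ _ "{0<..}"])
    show "((\<lambda>t. t ^ k *\<^sub>R F (x, y)) has_derivative (\<lambda>t. (real k * t) *\<^sub>R F (x, y))) (at 1)"
      by (auto intro!: derivative_eq_intros)
  qed (use z in \<open>auto simp: homogeneous_onD[OF F(2)]\<close>)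
  ultimately have "(\<lambda>t. D F (x, y) (0, t *\<^sub>R y)) = (\<lambda>t. (real k * t) *\<^sub>R F (x, y))"
    by (rule has_derivative_unique)
  from fun_cong[OF this, of 1] show ?thesis by simp
qed

section \<open>The Jacobi endomorphism under a projective change of the spray\<close>

text \<open>The Jacobi endomorphism \<open>R\<^sup>h\<^sub>k u\<^sup>k\<close> of the spray with coefficients \<open>G\<close>, free of indices: the two terms
with second derivatives combine into the derivative along the spray vector field \<open>(y, - 2 G)\<close>.\<close>
definition jacobi ::
    "((real^'n) \<times> (real^'n) \<Rightarrow> real^'n) \<Rightarrow> (real^'n) \<times> (real^'n) \<Rightarrow> real^'n \<Rightarrow> real^'n" where
  "jacobi G z u = 2 *\<^sub>R D G z (u, 0) - D (\<lambda>w. D G w (0, u)) z (snd z, - 2 *\<^sub>R G z)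
     - D G z (0, D G z (0, u))"

lemma jacobi_cong:
  assumes "open W" "z \<in> W" "\<And>w. w \<in> W \<Longrightarrow> G w = H w"
  shows "jacobi G z u = jacobi H z u"
proof -
  have 1: "D G w = D H w" if "w \<in> W" for w using D_cong assms that by blast
  have 2: "D (\<lambda>w. D G w (0, u)) z = D (\<lambda>w. D H w (0, u)) z"
    by (rule D_cong[OF assms(1,2)]) (simp add: 1)
  show ?thesis using 1 2 assms by (simp add: jacobi_def)
qed

text \<open>The coefficient of \<open>y\<close> in the change of the Jacobi endomorphism under \<open>G \<mapsto> G + P y\<close>. In the usual
notation it is \<open>3 (P\<^sub>;\<^sub>k - P \<partial>'\<^sub>k P) + \<partial>'\<^sub>k \<Xi>\<close> with \<open>\<Xi> = P\<^sup>2 - P\<^sub>;\<^sub>m y\<^sup>m\<close>, written out.\<close>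
definition projective_tau ::
    "((real^'n) \<times> (real^'n) \<Rightarrow> real^'n) \<Rightarrow> ((real^'n) \<times> (real^'n) \<Rightarrow> real) \<Rightarrow>
     real^'n \<Rightarrow> (real^'n) \<times> (real^'n) \<Rightarrow> real" where
  "projective_tau G P u z = 2 * D P z (u, 0) - D (\<lambda>w. D P w (0, u)) z (snd z, - 2 *\<^sub>R G z)
     - D P z (0, D G z (0, u)) - P z * D P z (0, u)"

text \<open>All terms are expanded with the product rule. The new spray field is the old one minus \<open>2 P\<close> times
the Liouville field \<open>(0, y)\<close>, along which every function involved is homogeneous, so Euler's theorem
evaluates those derivatives; the terms with \<open>\<partial>'G\<close> and \<open>G\<close> then cancel.\<close>
lemma jacobi_projective:
  fixes G :: "(real^'n) \<times> (real^'n) \<Rightarrow> real^'n" and P :: "(real^'n) \<times> (real^'n) \<Rightarrow> real"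
  assumes U: "open U" and G: "smooth_on (U \<times> -{0}) G" "homogeneous_on 2 U G"
    and P: "smooth_on (U \<times> -{0}) P" "homogeneous_on 1 U P" and z: "z \<in> U \<times> -{0}"
  shows "jacobi (\<lambda>w. G w + P w *\<^sub>R snd w) z u = jacobi G z u
     + ((P z)\<^sup>2 - D P z (snd z, - 2 *\<^sub>R G z)) *\<^sub>R u + projective_tau G P u z *\<^sub>R snd z"
proof -
  let ?W = "U \<times> - {0 :: real^'n}"
  let ?H = "\<lambda>w. G w + P w *\<^sub>R snd w"
  note W = open_slit[OF U]
  obtain x y where xy: "z = (x, y)" "x \<in> U" "y \<noteq> 0" using z by auto
  have sn: "smooth_on ?W snd" using smooth_on_snd[OF smooth_on_id[OF W] W] .
  have Psn: "smooth_on ?W (\<lambda>w. P w *\<^sub>R snd w)" by (rule smooth_on_scaleR[OF P(1) sn W])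
  have Dsn: "D snd w v = snd v" for w v :: "(real^'n) \<times> (real^'n)"
    by (rule D_linear[OF bounded_linear_snd])
  have DH: "D ?H w v = D G w v + (P w *\<^sub>R snd v + D P w v *\<^sub>R snd w)" if "w \<in> ?W" for w v
    using D_add[OF G(1) Psn that] D_scaleR[OF P(1) sn that] by (simp add: Dsn)
  define X where "X = (\<lambda>w. D G w (0, u))"
  define Q where "Q = (\<lambda>w. D P w (0, u))"
  have X: "smooth_on ?W X" "homogeneous_on 1 U X"
    unfolding X_def using smooth_on_D[OF G(1)] homogeneous_on_Dy[OF G(1) _ U, of 1] G(2)
    by (simp_all add: numeral_2_eq_2)
  have Q: "smooth_on ?W Q" "homogeneous_on 0 U Q"
    unfolding Q_def using smooth_on_D[OF P(1)] homogeneous_on_Dy[OF P(1) _ U, of 0] P(2)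
    by (simp_all)
  have Pu: "smooth_on ?W (\<lambda>w. P w *\<^sub>R u)" by (rule smooth_on_scaleR[OF P(1) smooth_on_const W])
  have Qs: "smooth_on ?W (\<lambda>w. Q w *\<^sub>R snd w)" by (rule smooth_on_scaleR[OF Q(1) sn W])
  have sum: "smooth_on ?W (\<lambda>w. P w *\<^sub>R u + Q w *\<^sub>R snd w)" by (rule smooth_on_add[OF Pu Qs W])
  have N: "D ?H w (0, u) = X w + (P w *\<^sub>R u + Q w *\<^sub>R snd w)" if "w \<in> ?W" for w
    using DH[OF that] by (simp add: X_def Q_def)
  have "D (\<lambda>w. D ?H w (0, u)) z = D (\<lambda>w. X w + (P w *\<^sub>R u + Q w *\<^sub>R snd w)) z"
    by (rule D_cong[OF W z N])
  then have DN: "D (\<lambda>w. D ?H w (0, u)) z v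
      = D X z v + (D P z v *\<^sub>R u + (Q z *\<^sub>R snd v + D Q z v *\<^sub>R snd z))" for v
    using D_add[OF X(1) sum z] D_add[OF Pu Qs z] D_scaleR[OF Q(1) sn z]
      D_scaleR[OF P(1) smooth_on_const z] by (simp add: Dsn)
  have S: "D F z (snd z, - 2 *\<^sub>R ?H z) = D F z (snd z, - 2 *\<^sub>R G z) - (2 * P z) *\<^sub>R D F z (0, y)"
    if "smooth_on ?W F" for F :: "(real^'n) \<times> (real^'n) \<Rightarrow> 'b::real_normed_vector"
  proof -
    have "(snd z, - 2 *\<^sub>R ?H z) = (snd z, - 2 *\<^sub>R G z) - (2 * P z) *\<^sub>R (0, y)"
      by (simp add: xy algebra_simps)
    then show ?thesis using smooth_on_linear_D[OF that z] by (simp only: linear_diff linear_scale)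
  qed
  \<comment> \<open>Euler's theorem in degrees 1, 0, 1 and 2.\<close>
  have EX: "D X z (0, y) = X z" and EQ: "D Q z (0, y) = 0" and EP: "D P z (0, y) = P z"
    and EG: "D G z (0, y) = 2 *\<^sub>R G z"
    using euler_homogeneous[OF X xy(2,3)] euler_homogeneous[OF Q xy(2,3)]
      euler_homogeneous[OF P xy(2,3)] euler_homogeneous[OF G xy(2,3)] by (simp_all add: xy(1))
  have lin: "D F z (0, X z + (P z *\<^sub>R u + Q z *\<^sub>R snd z))
      = D F z (0, X z) + (P z *\<^sub>R D F z (0, u) + Q z *\<^sub>R D F z (0, y))"
    if "smooth_on ?W F" for F :: "(real^'n) \<times> (real^'n) \<Rightarrow> 'b::real_normed_vector"
  proof -
    have "(0 :: real^'n, X z + (P z *\<^sub>R u + Q z *\<^sub>R snd z)) = (0, X z) + (P z *\<^sub>R (0, u) + Q z *\<^sub>R (0, y))"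
      by (simp add: xy algebra_simps)
    then show ?thesis using smooth_on_linear_D[OF that z] by (simp only: linear_add linear_scale)
  qed
  have 1: "D ?H z (u, 0) = D G z (u, 0) + D P z (u, 0) *\<^sub>R y"
    using DH[OF z] xy by simp
  have 2: "D (\<lambda>w. D ?H w (0, u)) z (snd z, - 2 *\<^sub>R ?H z)
      = D X z (snd z, - 2 *\<^sub>R G z) - (2 * P z) *\<^sub>R X z
        + ((D P z (snd z, - 2 *\<^sub>R G z) - 2 * P z * P z) *\<^sub>R u
        + (Q z *\<^sub>R (- 2 *\<^sub>R (G z + P z *\<^sub>R y)) + D Q z (snd z, - 2 *\<^sub>R G z) *\<^sub>R y))"
    unfolding DN S[OF X(1)] S[OF P(1)] S[OF Q(1)] EX EQ EP using xy by simp
  have 3: "D ?H z (0, D ?H z (0, u)) = D G z (0, X z) + (P z *\<^sub>R X z + Q z *\<^sub>R (2 *\<^sub>R G z))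
      + (P z *\<^sub>R (X z + (P z *\<^sub>R u + Q z *\<^sub>R y))
      + (D P z (0, X z) + (P z * Q z + Q z * P z)) *\<^sub>R y)"
    unfolding N[OF z] unfolding DH[OF z] lin[OF G(1)] lin[OF P(1)] EG EP
    using xy by (simp add: X_def Q_def)
  have Xz: "D G z (0, u) = X z" and Qz: "D P z (0, u) = Q z" and X': "(\<lambda>w. D G w (0, u)) = X"
    and Q': "(\<lambda>w. D P w (0, u)) = Q" by (auto simp: X_def Q_def)
  show ?thesis
    unfolding jacobi_def projective_tau_def 1 2 3 Xz Qz X' Q'
    by (simp add: vec_eq_iff xy power2_eq_square) (simp add: algebra_simps)
qed

section \<open>The spray of a Finsler function\<close>

lemma linear_sum_axis:
  fixes f :: "real^'n \<Rightarrow> 'b::real_vector" assumes "linear f"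
  shows "(\<Sum>k\<in>UNIV. (v $ k) *\<^sub>R f (axis k 1)) = f v"
proof -
  have "f v = f (\<Sum>k\<in>UNIV. (v $ k) *\<^sub>R axis k 1)"
    using basis_expansion[of v] by (simp add: scalar_mult_eq_scaleR)
  then show ?thesis by (simp add: linear_sum[OF assms] linear_scale[OF assms])
qed

lemma linear_sum_axis_x:
  fixes f :: "(real^'n) \<times> (real^'n) \<Rightarrow> real" assumes f: "linear f"
  shows "(\<Sum>k\<in>UNIV. v $ k * f (axis k 1, 0)) = f (v, 0)"
proof -
  have "linear (\<lambda>v. (v, 0 :: real^'n))" by (rule linearI) auto
  from linear_sum_axis[OF linear_compose[OF this f], of v] show ?thesis by (simp add: o_def)
qed

lemma linear_sum_axis_y:
  fixes f :: "(real^'n) \<times> (real^'n) \<Rightarrow> real" assumes f: "linear f"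
  shows "(\<Sum>k\<in>UNIV. v $ k * f (0, axis k 1)) = f (0, v)"
proof -
  have "linear (\<lambda>v. (0 :: real^'n, v))" by (rule linearI) auto
  from linear_sum_axis[OF linear_compose[OF this f], of v] show ?thesis by (simp add: o_def)
qed

lemma smooth_on_det:
  fixes M :: "'a::real_normed_vector \<Rightarrow> real^'n^'n"
  assumes "\<And>i j. smooth_on S (\<lambda>z. M z $ i $ j)" "open S"
  shows "smooth_on S (\<lambda>z. det (M z))"
  unfolding det_def by (intro smooth_on_sum smooth_on_mult smooth_on_prod smooth_on_const assms)

lemma matrix_inv_inverse:
  fixes A :: "real^'n^'n" assumes "invertible A"
  shows "A ** matrix_inv A = mat 1" "matrix_inv A ** A = mat 1"
proof -
  have "A ** matrix_inv A = mat 1 \<and> matrix_inv A ** A = mat 1"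
    unfolding matrix_inv_def by (rule someI_ex) (use assms in \<open>simp add: invertible_def\<close>)
  then show "A ** matrix_inv A = mat 1" "matrix_inv A ** A = mat 1" by auto
qed

lemma matrix_inv_mult_cramer:
  fixes A :: "real^'n^'n"
  assumes "det A \<noteq> 0"
  shows "matrix_inv A *v b = (\<chi> k. det (\<chi> i j. if j = k then b $ i else A $ i $ j) / det A)"
proof -
  have "A *v (matrix_inv A *v b) = b"
    using matrix_inv_inverse(1)[of A] assms by (simp add: invertible_det_nz matrix_vector_mul_assoc)
  then show ?thesis using cramer[OF assms] by blast
qed

definition spray_vec :: "((real^'n::finite) \<times> (real^'n) \<Rightarrow> real) \<Rightarrow> (real^'n) \<times> (real^'n) \<Rightarrow> real^'n" where
  "spray_vec F z = (\<chi> i. spray F i z)"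

lemma spray_eq_spray_vec: "spray F i = (\<lambda>z. spray_vec F z $ i)"
  by (simp add: spray_vec_def fun_eq_iff)

text \<open>The coordinate expression of a Finsler function on an open part \<open>U\<close> of a chart. Restricting to a
part is necessary because Minkowski coordinates exist only locally.\<close>
locale finsler_coordinates =
  fixes U :: "(real^'n) set" and F :: "(real^'n) \<times> (real^'n) \<Rightarrow> real"
  assumes open_U: "open U"
    and smooth_F: "smooth_on (U \<times> -{0}) F"
    and homogeneous_F: "\<And>x y r. x \<in> U \<Longrightarrow> r > 0 \<Longrightarrow> F (x, r *\<^sub>R y) = r * F (x, y)"
    and metric_pos: "\<And>x y v. x \<in> U \<Longrightarrow> y \<noteq> 0 \<Longrightarrow> v \<noteq> 0 \<Longrightarrow> v \<bullet> (metric_tensor F (x, y) *v v) > 0"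
begin

abbreviation "W \<equiv> U \<times> - {0 :: real^'n}"
abbreviation "E \<equiv> \<lambda>w. (F w)\<^sup>2"

lemma open_W: "open W"
  by (rule open_slit[OF open_U])

lemma smooth_E: "smooth_on W E"
  using smooth_on_mult[OF smooth_F smooth_F open_W] by (simp add: power2_eq_square)

lemma homogeneous_E: "homogeneous_on 2 U E"
  by (simp add: homogeneous_on_def homogeneous_F power_mult_distrib)

lemma homogeneous_E_y: "homogeneous_on 1 U (\<lambda>w. D E w (0, v))"
  using homogeneous_on_Dy[OF smooth_E _ open_U, of 1] homogeneous_E by (simp add: numeral_2_eq_2)

lemma homogeneous_E_yy: "homogeneous_on 0 U (\<lambda>w. D (\<lambda>w. D E w (0, v)) w (0, v'))"
  using homogeneous_on_Dy[OF smooth_on_D[OF smooth_E] _ open_U, of 0] homogeneous_E_y by simp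

text \<open>The fundamental tensor is half the fibre Hessian of \<open>E = F\<^sup>2\<close>; the symmetry of second derivatives
lets the index \<open>l\<close> be the inner derivative, as in the Euler-Lagrange equations.\<close>
lemma metric_mult:
  assumes z: "z \<in> W"
  shows "(metric_tensor F z *v q) $ l = D (\<lambda>w. D E w (0, axis l 1)) z (0, q) / 2"
proof -
  have "metric_tensor F z $ l $ i = D (\<lambda>w. D E w (0, axis l 1)) z (0, axis i 1) / 2" for i
    by (simp add: metric_tensor_def pd_y_def[abs_def] D_D_commute[OF smooth_E open_W z])
  note g = this
  have lin: "linear (D (\<lambda>w. D E w (0, axis l 1)) z)"
    by (rule smooth_on_linear_D[OF smooth_on_D[OF smooth_E] z])
  have "(metric_tensor F z *v q) $ l
      = (\<Sum>i\<in>UNIV. q $ i * D (\<lambda>w. D E w (0, axis l 1)) z (0, axis i 1)) / 2"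
    unfolding matrix_vector_mult_def vec_lambda_beta g sum_divide_distrib by (rule sum.cong) auto
  then show ?thesis unfolding linear_sum_axis_y[OF lin] .
qed

lemma det_metric: 
  assumes "z \<in> W" shows "det (metric_tensor F z) \<noteq> 0"
proof -
  have "\<exists>v. v \<noteq> 0 \<and> metric_tensor F z *v v = 0" if "det (metric_tensor F z) = 0"
    using that by (metis invertible_det_nz invertible_left_inverse matrix_left_invertible_ker)
  moreover have "metric_tensor F z *v v \<noteq> 0" if "v \<noteq> 0" for v
  proof -
    obtain x y where "z = (x, y)" "x \<in> U" "y \<noteq> 0" using assms by auto
    then show ?thesis using metric_pos[of x y v] that by auto
  qed
  ultimately show ?thesis by blast
qed

text \<open>The vector \<open>4 g G\<close>, by which the spray is defined.\<close>
definition euler_lagrange_rhs :: "(real^'n) \<times> (real^'n) \<Rightarrow> real^'n" where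
  "euler_lagrange_rhs z = (\<chi> l. D (\<lambda>w. D E w (0, axis l 1)) z (snd z, 0) - D E z (axis l 1, 0))"

lemma spray_vec_eq:
  assumes z: "z \<in> W"
  shows "spray_vec F z = (1 / 4) *\<^sub>R (matrix_inv (metric_tensor F z) *v euler_lagrange_rhs z)"
proof -
  have "(\<Sum>k\<in>UNIV. snd z $ k * pd_x k (pd_y l E) z) - pd_x l E z = euler_lagrange_rhs z $ l" for l
    using linear_sum_axis_x[OF smooth_on_linear_D[OF smooth_on_D[OF smooth_E] z]]
    by (simp add: euler_lagrange_rhs_def pd_x_def pd_y_def[abs_def])
  then show ?thesis
    by (simp add: vec_eq_iff spray_vec_def spray_def matrix_vector_mult_def)
qed

text \<open>The Euler-Lagrange equations \<open>S(\<partial>'\<^sub>l E) = \<partial>\<^sub>l E\<close> determine the vector field \<open>S = (y, - 2 q)\<close>, because the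
fundamental tensor is invertible. They are easier to verify in concrete coordinates than the
formula with the inverse matrix.\<close>
lemma spray_vec_unique:
  assumes z: "z \<in> W"
    and EL: "\<And>l. D (\<lambda>w. D E w (0, axis l 1)) z (snd z, - 2 *\<^sub>R q) = D E z (axis l 1, 0)"
  shows "spray_vec F z = q"
proof -
  let ?g = "metric_tensor F z"
  have "(?g *v (4 *\<^sub>R q)) $ l = euler_lagrange_rhs z $ l" for l
  proof -
    have "D (\<lambda>w. D E w (0, axis l 1)) z ((snd z, 0) - 2 *\<^sub>R (0, q)) = D E z (axis l 1, 0)"
      using EL[of l] by simp
    moreover have "D (\<lambda>w. D E w (0, axis l 1)) z (4 *\<^sub>R (0, q)) = 4 * D (\<lambda>w. D E w (0, axis l 1)) z (0, q)"
      by (subst linear_scale[OF smooth_on_linear_D[OF smooth_on_D[OF smooth_E] z]]) simp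
    ultimately show ?thesis
      using smooth_on_linear_D[OF smooth_on_D[OF smooth_E] z]
      by (simp add: metric_mult[OF z] euler_lagrange_rhs_def linear_diff linear_scale del: scaleR_Pair diff_Pair)
  qed
  then have "?g *v (4 *\<^sub>R q) = euler_lagrange_rhs z" by (simp add: vec_eq_iff)
  then have "matrix_inv ?g *v euler_lagrange_rhs z = 4 *\<^sub>R q"
    using matrix_inv_inverse(2)[of ?g] det_metric[OF z]
    by (metis invertible_det_nz matrix_vector_mul_assoc matrix_vector_mul_lid)
  then show ?thesis by (simp add: spray_vec_eq[OF z])
qed

lemma smooth_metric: "smooth_on W (\<lambda>z. metric_tensor F z $ i $ j)"
proof -
  have "(\<lambda>z. metric_tensor F z $ i $ j) = (\<lambda>z. (1 / 2) * D (\<lambda>w. D E w (0, axis j 1)) z (0, axis i 1))"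
    by (simp add: metric_tensor_def pd_y_def[abs_def])
  then show ?thesis
    using smooth_on_mult[OF smooth_on_const smooth_on_D[OF smooth_on_D[OF smooth_E]] open_W] by metis
qed

lemma smooth_euler_lagrange_rhs: "smooth_on W euler_lagrange_rhs"
  unfolding euler_lagrange_rhs_def[abs_def]
proof (intro smooth_on_vec smooth_on_diff open_W)
  fix l
  show "smooth_on W (\<lambda>z. D (\<lambda>w. D E w (0, axis l 1)) z (snd z, 0))"
    by (rule smooth_on_linear_family[where A="\<lambda>z. D (\<lambda>w. D E w (0, axis l 1)) z"])
       (intro smooth_on_D smooth_E smooth_on_linear_D[OF smooth_on_D[OF smooth_E]] open_W
         smooth_on_Pair smooth_on_snd smooth_on_id smooth_on_const | assumption)+
qed (rule smooth_on_D[OF smooth_E])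

text \<open>Cramer's rule makes the dependence of the inverse matrix on its entries visibly smooth.\<close>
lemma smooth_spray: "smooth_on W (spray_vec F)"
proof (rule smooth_on_cong[OF open_W])
  show "(1 / 4) *\<^sub>R (\<chi> k. det (\<chi> i j. if j = k then euler_lagrange_rhs z $ i
      else metric_tensor F z $ i $ j) / det (metric_tensor F z)) = spray_vec F z" if "z \<in> W" for z
    using spray_vec_eq[OF that] matrix_inv_mult_cramer[OF det_metric[OF that]] by simp
  have "smooth_on W (\<lambda>z. if c then euler_lagrange_rhs z $ i else metric_tensor F z $ i $ j)" for c i j
    using smooth_metric smooth_on_nth[OF smooth_euler_lagrange_rhs open_W] by (cases c) auto
  then show "smooth_on W (\<lambda>z. (1 / 4) *\<^sub>R (\<chi> k. det (\<chi> i j. if j = k then euler_lagrange_rhs z $ i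
      else metric_tensor F z $ i $ j) / det (metric_tensor F z)))"
    by (intro smooth_on_scaleR smooth_on_const smooth_on_vec smooth_on_divide smooth_on_det
        smooth_metric det_metric open_W) simp_all
qed

lemma homogeneous_spray: "homogeneous_on 2 U (spray_vec F)"
  unfolding homogeneous_on_def
proof (intro ballI allI impI)
  fix x y :: "real^'n" and r :: real assume *: "x \<in> U" "y \<noteq> 0" "r > 0"
  have z: "(x, y) \<in> W" and rz: "(x, r *\<^sub>R y) \<in> W" using * by auto
  have g: "metric_tensor F (x, r *\<^sub>R y) = metric_tensor F (x, y)"
    using homogeneous_onD[OF homogeneous_E_yy *]
    by (simp add: metric_tensor_def pd_y_def[abs_def])
  have "D (\<lambda>w. D E w (0, v)) (x, r *\<^sub>R y) (r *\<^sub>R y, 0) = r\<^sup>2 * D (\<lambda>w. D E w (0, v)) (x, y) (y, 0)" for v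
    using linear_scale[OF smooth_on_linear_D[OF smooth_on_D[OF smooth_E] rz], of "(0, v)" r "(y, 0)"]
      homogeneous_onD[OF homogeneous_on_Dx[OF smooth_on_D[OF smooth_E] homogeneous_E_y open_U] *]
    by (simp add: power2_eq_square)
  then have "euler_lagrange_rhs (x, r *\<^sub>R y) = r\<^sup>2 *\<^sub>R euler_lagrange_rhs (x, y)"
    using homogeneous_onD[OF homogeneous_on_Dx[OF smooth_E homogeneous_E open_U] *]
    by (simp add: euler_lagrange_rhs_def vec_eq_iff right_diff_distrib)
  then show "spray_vec F (x, r *\<^sub>R y) = r\<^sup>2 *\<^sub>R spray_vec F (x, y)"
    unfolding spray_vec_eq[OF z] spray_vec_eq[OF rz] g
    by (simp add: matrix_vector_mult_scaleR)
qed

lemma smooth_spray_component: "smooth_on W (spray F i)"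
  unfolding spray_eq_spray_vec by (rule smooth_on_nth[OF smooth_spray open_W])

lemma D_spray:
  assumes "w \<in> W" shows "D (spray F i) w v = D (spray_vec F) w v $ i"
  unfolding spray_eq_spray_vec by (rule D_bounded_linear[OF bounded_linear_vec_nth smooth_spray assms])

lemma DD_spray:
  assumes "w \<in> W" shows "D (\<lambda>w. D (spray F i) w u) w v = D (\<lambda>w. D (spray_vec F) w u) w v $ i"
proof -
  have "D (\<lambda>w. D (spray F i) w u) w = D (\<lambda>w. D (spray_vec F) w u $ i) w"
    by (rule D_cong[OF open_W assms D_spray])
  then show ?thesis
    using D_bounded_linear[OF bounded_linear_vec_nth smooth_on_D[OF smooth_spray] assms] by simp
qed

lemma riemann_eq_jacobi:
  assumes z: "z \<in> W"
  shows "riemann F h k z = jacobi (spray_vec F) z (axis k 1) $ h"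
proof -
  let ?N = "\<lambda>w. D (spray F h) w (0, axis k 1)"
  have N: "linear (D ?N z)" and G: "linear (D (spray F h) z)"
    using smooth_on_linear_D[OF _ z] smooth_on_D smooth_spray_component by blast+
  have "(snd z, - 2 *\<^sub>R spray_vec F z) = (snd z, 0) - 2 *\<^sub>R (0, spray_vec F z)" by simp
  then have "D ?N z (snd z, - 2 *\<^sub>R spray_vec F z) = D ?N z (snd z, 0) - 2 * D ?N z (0, spray_vec F z)"
    by (simp only: linear_diff[OF N] linear_scale[OF N] real_scaleR_def)
  then have "- (\<Sum>j\<in>UNIV. snd z $ j * D ?N z (axis j 1, 0)) + 2 * (\<Sum>j\<in>UNIV. spray F j z * D ?N z (0, axis j 1))
      = - D ?N z (snd z, - 2 *\<^sub>R spray_vec F z)"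
    using linear_sum_axis_x[OF N, of "snd z"] linear_sum_axis_y[OF N, of "spray_vec F z"]
    by (simp add: spray_vec_def)
  moreover have "(\<Sum>j\<in>UNIV. D (spray F h) z (0, axis j 1) * D (spray F j) z (0, axis k 1))
      = D (spray F h) z (0, D (spray_vec F) z (0, axis k 1))"
    using linear_sum_axis_y[OF G, of "D (spray_vec F) z (0, axis k 1)"]
    by (simp add: D_spray[OF z] mult.commute)
  ultimately show ?thesis
    unfolding riemann_def jacobi_def pd_x_def pd_y_def[abs_def]
    by (simp add: D_spray[OF z] DD_spray[OF z])
qed

text \<open>Contracting \<open>R\<^sup>h\<^sub>k = \<Xi> \<delta>\<^sup>h\<^sub>k + \<tau>\<^sub>k y\<^sup>h\<close> with \<open>\<tau>\<^sub>m y\<^sup>m = - \<Xi>\<close> gives \<open>(n - 1) \<Xi>\<close>, so the trace-free part is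
\<open>\<tau>\<^sub>k y\<^sup>h\<close>; by Euler's theorem its divergence is \<open>(n + 1) \<tau>\<^sub>k\<close>, and the Weyl deviation vanishes.\<close>
lemma weyl_torsion_eq_0_if_isotropic:
  assumes R: "\<And>w h k. w \<in> W \<Longrightarrow> riemann F h k w = (if h = k then \<Xi> w else 0) + \<tau> k w * snd w $ h"
    and \<tau>: "\<And>k. smooth_on W (\<tau> k)" "\<And>k. homogeneous_on 1 U (\<tau> k)"
    and tr: "\<And>w. w \<in> W \<Longrightarrow> (\<Sum>k\<in>UNIV. \<tau> k w * snd w $ k) = - \<Xi> w"
    and z: "z \<in> W"
  shows "weyl_torsion F h i j z = 0"
proof (cases "CARD('n) = 1")
  \<comment> \<open>The trace is divided by \<open>n - 1 = 0\<close>, but the torsion is antisymmetric in \<open>i\<close>, \<open>j\<close>.\<close>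
  case True
  then have "i = j" by (metis UNIV_I card_1_singletonE singletonD)
  then show ?thesis by (simp add: weyl_torsion_def)
next
  case False
  have n: "real CARD('n) - 1 \<noteq> 0" using False by auto
  have red: "riemann_reduced F h k w = \<tau> k w * snd w $ h" if "w \<in> W" for w h k
  proof -
    have "riemann_trace F w = \<Xi> w"
      using n by (simp add: riemann_trace_def R[OF that] sum.distrib tr[OF that] field_simps)
    then show ?thesis by (simp add: riemann_reduced_def R[OF that])
  qed
  have dev: "weyl_deviation F h k w = 0" if w: "w \<in> W" for w h k
  proof -
    have sn: "smooth_on W (\<lambda>w. snd w $ m)" for m
      by (intro smooth_on_nth smooth_on_snd smooth_on_id open_W)
    have "pd_y m (riemann_reduced F m k) w = \<tau> k w + snd w $ m * D (\<tau> k) w (0, axis m 1)" for m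
    proof -
      have "D (riemann_reduced F m k) w = D (\<lambda>w. \<tau> k w * snd w $ m) w"
        by (rule D_cong[OF open_W w red])
      moreover have "D (\<lambda>w :: (real^'n) \<times> (real^'n). snd w $ m) w v = snd v $ m" for v
        by (rule D_linear) (rule bounded_linear_compose[OF bounded_linear_vec_nth bounded_linear_snd])
      ultimately show ?thesis
        by (simp add: pd_y_def D_mult[OF \<tau>(1) sn w] axis_def)
    qed
    moreover have "D (\<tau> k) w (0, snd w) = \<tau> k w"
    proof -
      obtain x y where "w = (x, y)" "x \<in> U" "y \<noteq> 0" using w by auto
      then show ?thesis using euler_homogeneous[OF \<tau>(1) \<tau>(2), of x y] by simp
    qed
    ultimately have "(\<Sum>m\<in>UNIV. pd_y m (riemann_reduced F m k) w) = (real CARD('n) + 1) * \<tau> k w"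
      using linear_sum_axis_y[OF smooth_on_linear_D[OF \<tau>(1) w], of "snd w" k]
      by (simp add: sum.distrib algebra_simps)
    moreover have "real CARD('n) + 1 \<noteq> 0" by linarith
    ultimately show ?thesis by (simp add: weyl_deviation_def red[OF w])
  qed
  have "pd_y m (weyl_deviation F h k) z = 0" for m k
    using D_cong[OF open_W z, of "weyl_deviation F h k" "\<lambda>_. 0"] dev
    by (simp add: pd_y_def)
  then show ?thesis by (simp add: weyl_torsion_def)
qed

end

section \<open>The projective factor\<close>

context
  fixes U :: "(real^'n) set" and G :: "(real^'n) \<times> (real^'n) \<Rightarrow> real^'n" and P
  assumes U: "open U"
    and G: "smooth_on (U \<times> -{0}) G" "homogeneous_on 2 U G"
    and P: "smooth_on (U \<times> -{0}) P" "homogeneous_on 1 U (P :: (real^'n) \<times> (real^'n) \<Rightarrow> real)"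
begin

lemma smooth_projective_tau: "smooth_on (U \<times> -{0}) (projective_tau G P u)"
proof -
  note W = open_slit[OF U]
  have lin: "smooth_on (U \<times> -{0}) (\<lambda>z. D f z (k z))"
    if "smooth_on (U \<times> -{0}) f" "smooth_on (U \<times> -{0}) k" for f :: "(real^'n) \<times> (real^'n) \<Rightarrow> real" and k
    by (rule smooth_on_linear_family[of _ "D f", OF smooth_on_D[OF that(1)] smooth_on_linear_D[OF that(1)] that(2) W])
  show ?thesis
    unfolding projective_tau_def[abs_def]
    by (intro smooth_on_diff smooth_on_mult smooth_on_const smooth_on_D[OF P(1)] P(1) W lin
        smooth_on_Pair smooth_on_snd[OF smooth_on_id] smooth_on_scaleR G(1) smooth_on_D[OF G(1)]
        smooth_on_D[OF smooth_on_D[OF P(1)]])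
qed

lemma homogeneous_projective_tau: "homogeneous_on 1 U (projective_tau G P u)"
  unfolding homogeneous_on_def
proof (intro ballI allI impI)
  fix x y :: "real^'n" and r :: real assume *: "x \<in> U" "y \<noteq> 0" "r > 0"
  let ?Q = "\<lambda>w. D P w (0, u)"
  have rz: "(x, r *\<^sub>R y) \<in> U \<times> -{0}" using * by auto
  have Q: "smooth_on (U \<times> -{0}) ?Q" "homogeneous_on 0 U ?Q"
    using smooth_on_D[OF P(1)] homogeneous_on_Dy[OF P(1) _ U, of 0] P(2) by simp_all
  have "(r *\<^sub>R y, - 2 *\<^sub>R G (x, r *\<^sub>R y)) = r *\<^sub>R (y, r *\<^sub>R (- 2 *\<^sub>R G (x, y)))"
    using homogeneous_onD[OF G(2) *] by (simp add: power2_eq_square)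
  note S = this
  have 1: "D ?Q (x, r *\<^sub>R y) (r *\<^sub>R y, - 2 *\<^sub>R G (x, r *\<^sub>R y)) = r * D ?Q (x, y) (y, - 2 *\<^sub>R G (x, y))"
    unfolding S linear_scale[OF smooth_on_linear_D[OF Q(1) rz]] D_homogeneous[OF Q U *] by simp
  have "D G (x, r *\<^sub>R y) (0, u) = r *\<^sub>R D G (x, y) (0, u)"
    using homogeneous_onD[OF homogeneous_on_Dy[OF G(1) _ U, of 1] *] G(2) by (simp add: numeral_2_eq_2)
  then have 2: "D P (x, r *\<^sub>R y) (0, D G (x, r *\<^sub>R y) (0, u)) = r * D P (x, y) (0, D G (x, y) (0, u))"
    using D_homogeneous[OF P U *] by simp
  show "projective_tau G P u (x, r *\<^sub>R y) = r ^ 1 *\<^sub>R projective_tau G P u (x, y)"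
    using 1 2 homogeneous_onD[OF homogeneous_on_Dx[OF P U] *] homogeneous_onD[OF P(2) *]
      homogeneous_onD[OF Q(2) *]
    by (simp add: projective_tau_def algebra_simps)
qed

text \<open>By symmetry of second derivatives \<open>\<tau>\<close> is linear in \<open>u\<close>, so the sum is \<open>\<tau>\<close> at \<open>u = y\<close> with \<open>y\<close> held
fixed under the outer derivative. Differentiating Euler's identity \<open>\<partial>'P(y) = P\<close> along the spray
expresses the second derivative by first ones.\<close>
lemma sum_projective_tau:
  assumes z: "z \<in> U \<times> -{0}"
  shows "(\<Sum>k\<in>UNIV. projective_tau G P (axis k 1) z * snd z $ k)
    = D P z (snd z, - 2 *\<^sub>R G z) - (P z)\<^sup>2"
proof -
  let ?W = "U \<times> - {0 :: real^'n}"
  let ?S = "(snd z, - 2 *\<^sub>R G z)"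
  note W = open_slit[OF U]
  obtain x y where xy: "z = (x, y)" "x \<in> U" "y \<noteq> 0" using z by auto
  have comm: "D (\<lambda>w. D P w (0, u)) z v = D (\<lambda>w. D P w v) z (0, u)" for u v
    by (rule D_D_commute[OF P(1) W z])
  have linear_cmult: "linear (\<lambda>u. c * f u)" if "linear f" for c and f :: "real^'n \<Rightarrow> real"
    using linear_compose_scale_right[OF that, of c] by simp
  have linP: "linear (D P z)" and linG: "linear (D G z)" and linS: "linear (D (\<lambda>w. D P w ?S) z)"
    using smooth_on_linear_D[OF _ z] P(1) G(1) smooth_on_D[OF P(1)] by blast+
  have l0: "linear (\<lambda>v. (0 :: real^'n, v))" "linear (\<lambda>v. (v, 0 :: real^'n))"
    by (auto intro!: linearI)
  have "linear (\<lambda>u. projective_tau G P u z)"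
    unfolding projective_tau_def comm
    by (intro linear_compose_sub linear_compose[OF l0(1) linS, unfolded o_def]
        linear_compose[OF l0(2) linP, unfolded o_def] linear_compose[OF l0(1) linP, unfolded o_def]
        linear_compose[OF linear_compose[OF l0(1) linG] linear_compose[OF l0(1) linP], unfolded o_def]
        linear_cmult)
  from linear_sum_axis[OF this, of y]
  have "(\<Sum>k\<in>UNIV. projective_tau G P (axis k 1) z * snd z $ k) = projective_tau G P y z"
    by (simp add: xy mult.commute)
  moreover have "D P z ?S = D (\<lambda>w. D P w (0, y)) z ?S + D P z (0, - 2 *\<^sub>R G z)"
  proof -
    have "smooth_on ?W (\<lambda>w :: (real^'n) \<times> (real^'n). (0 :: real^'n, snd w))"
      by (intro smooth_on_Pair smooth_on_const smooth_on_snd smooth_on_id W)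
    note D_linear_family[OF smooth_on_D[OF P(1)] smooth_on_linear_D[OF P(1)] this W z, of ?S]
    moreover have "D (\<lambda>w :: (real^'n) \<times> (real^'n). (0 :: real^'n, snd w)) z v = (0, snd v)" for v
      by (rule D_linear) (intro bounded_linear_Pair bounded_linear_zero bounded_linear_snd)
    moreover have "D (\<lambda>w. D P w (0, snd w)) z = D P z"
    proof (rule D_cong[OF W z])
      fix w assume "w \<in> ?W"
      then obtain a b where "w = (a, b)" "a \<in> U" "b \<noteq> 0" by auto
      then show "D P w (0, snd w) = P w" using euler_homogeneous[OF P, of a b] by simp
    qed
    ultimately show ?thesis by (simp add: xy)
  qed
  moreover have "D P z ?S = D P z (y, 0) - 2 * D P z (0, G z)"
  proof -
    have "?S = (y, 0) - 2 *\<^sub>R (0, G z)" by (simp add: xy)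
    then show ?thesis by (simp only: linear_diff[OF linP] linear_scale[OF linP] real_scaleR_def)
  qed
  moreover have "D P z (0, - 2 *\<^sub>R G z) = - 2 * D P z (0, G z)" "D P z (0, 2 *\<^sub>R G z) = 2 * D P z (0, G z)"
    using linear_scale[OF linP, of "-2" "(0, G z)"] linear_scale[OF linP, of 2 "(0, G z)"] by simp_all
  moreover have "D G z (0, y) = 2 *\<^sub>R G z" "D P z (0, y) = P z"
    using euler_homogeneous[OF G xy(2,3)] euler_homogeneous[OF P xy(2,3)] by (simp_all add: xy)
  ultimately show ?thesis by (simp add: projective_tau_def power2_eq_square)
qed

end

lemma (in finsler_coordinates) weyl_torsion_eq_0:
  assumes G: "smooth_on W G" "homogeneous_on 2 U G" and P: "smooth_on W P" "homogeneous_on 1 U P"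
    and spray: "\<And>w. w \<in> W \<Longrightarrow> spray_vec F w = G w + P w *\<^sub>R snd w"
    and flat: "\<And>w u. w \<in> W \<Longrightarrow> jacobi G w u = 0"
    and z: "z \<in> W"
  shows "weyl_torsion F h i j z = 0"
proof (rule weyl_torsion_eq_0_if_isotropic[OF _ _ _ _ z])
  fix w h k assume w: "w \<in> W"
  have "jacobi (spray_vec F) w u = jacobi (\<lambda>w. G w + P w *\<^sub>R snd w) w u" for u
    by (rule jacobi_cong[OF open_W w spray])
  then show "riemann F h k w = (if h = k then (P w)\<^sup>2 - D P w (snd w, - 2 *\<^sub>R G w) else 0)
      + projective_tau G P (axis k 1) w * snd w $ h"
    using jacobi_projective[OF open_U G P w] flat[OF w] by (simp add: riemann_eq_jacobi[OF w] axis_def)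
next
  fix w assume "w \<in> W"
  then show "(\<Sum>k\<in>UNIV. projective_tau G P (axis k 1) w * snd w $ k)
      = - ((P w)\<^sup>2 - D P w (snd w, - 2 *\<^sub>R G w))"
    using sum_projective_tau[OF open_U G P] by simp
qed (rule smooth_projective_tau[OF open_U G P] homogeneous_projective_tau[OF open_U G P])+

section \<open>Sprays of linear connections\<close>

text \<open>Christoffel symbols of a torsion-free connection. The values lie in an arbitrary normed space so that
the same results apply to the scalar quadratic forms in the Douglas tensor.\<close>
locale symmetric_bilinear_family =
  fixes U :: "(real^'n) set" and \<Gamma> :: "real^'n \<Rightarrow> real^'n \<Rightarrow> real^'n \<Rightarrow> 'c::real_normed_vector"
  assumes open_U: "open U"
    and smooth_family: "\<And>u v. smooth_on U (\<lambda>x. \<Gamma> x u v)"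
    and linear_right: "\<And>x u. x \<in> U \<Longrightarrow> linear (\<Gamma> x u)"
    and symmetric: "\<And>x u v. x \<in> U \<Longrightarrow> \<Gamma> x u v = \<Gamma> x v u"
begin

abbreviation "W \<equiv> U \<times> - {0 :: real^'n}"

lemma open_W: "open W"
  by (rule open_slit[OF open_U])

lemma linear_left: "x \<in> U \<Longrightarrow> linear (\<lambda>u. \<Gamma> x u v)"
  using linear_right[of x v] symmetric[of x _ v] by (metis (no_types, lifting) ext)

lemma smooth_fst_right:
  assumes "smooth_on W q" shows "smooth_on W (\<lambda>z. \<Gamma> (fst z) u (q z))"
proof (rule smooth_on_linear_family[of W "\<lambda>z. \<Gamma> (fst z) u", OF _ _ assms open_W])
  show "smooth_on W (\<lambda>z. \<Gamma> (fst z) u v)" for v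
    by (rule smooth_on_compose[OF smooth_on_fst[OF smooth_on_id] smooth_family]) (auto simp: open_W)
qed (auto simp: linear_right)

lemma D_fst_right:
  assumes q: "smooth_on W q" and z: "z \<in> W"
  shows "D (\<lambda>z. \<Gamma> (fst z) u (q z)) z v
    = D (\<lambda>x. \<Gamma> x u (q z)) (fst z) (fst v) + \<Gamma> (fst z) u (D q z v)"
proof -
  have fz: "fst z \<in> U" using z by auto
  have f: "smooth_on W fst" using smooth_on_fst[OF smooth_on_id[OF open_W] open_W] .
  have "D (\<lambda>z. \<Gamma> (fst z) u (q z)) z v
      = D (\<lambda>w. \<Gamma> (fst w) u (q z)) z v + \<Gamma> (fst z) u (D q z v)"
    by (rule D_linear_family[of W "\<lambda>z. \<Gamma> (fst z) u", OF _ _ q open_W z])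
       (auto simp: linear_right intro!: smooth_fst_right smooth_on_const)
  also have "D (\<lambda>w. \<Gamma> (fst w) u (q z)) z v = D (\<lambda>x. \<Gamma> x u (q z)) (fst z) (fst v)"
    by (simp add: D_compose[OF f z smooth_family fz] D_linear[OF bounded_linear_fst])
  finally show ?thesis .
qed

lemma smooth_fst:
  assumes "smooth_on W p" "smooth_on W q" shows "smooth_on W (\<lambda>z. \<Gamma> (fst z) (p z) (q z))"
  by (rule smooth_on_linear_family[of W "\<lambda>z u. \<Gamma> (fst z) u (q z)", OF _ _ assms(1) open_W])
     (auto simp: linear_left intro!: smooth_fst_right assms)

lemma D_fst:
  assumes p: "smooth_on W p" and q: "smooth_on W q" and z: "z \<in> W"
  shows "D (\<lambda>z. \<Gamma> (fst z) (p z) (q z)) z v = D (\<lambda>x. \<Gamma> x (p z) (q z)) (fst z) (fst v)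
    + \<Gamma> (fst z) (p z) (D q z v) + \<Gamma> (fst z) (D p z v) (q z)"
proof -
  have "D (\<lambda>z. \<Gamma> (fst z) (p z) (q z)) z v
      = D (\<lambda>w. \<Gamma> (fst w) (p z) (q w)) z v + \<Gamma> (fst z) (D p z v) (q z)"
    by (rule D_linear_family[of W "\<lambda>z u. \<Gamma> (fst z) u (q z)", OF _ _ p open_W z])
       (auto simp: linear_left intro!: smooth_fst_right q)
  then show ?thesis by (simp add: D_fst_right[OF q z])
qed

text \<open>For vector-valued \<open>\<Gamma>\<close> these are the spray coefficients of the connection.\<close>
definition quadratic :: "(real^'n) \<times> (real^'n) \<Rightarrow> 'c" where
  "quadratic z = (1 / 2) *\<^sub>R \<Gamma> (fst z) (snd z) (snd z)"

lemma smooth_snd: "smooth_on W snd"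
  by (rule smooth_on_snd[OF smooth_on_id[OF open_W] open_W])

lemma D_snd: "D snd z v = snd v" for z v :: "(real^'n) \<times> (real^'n)"
  by (rule D_linear[OF bounded_linear_snd])

lemma smooth_quadratic: "smooth_on W quadratic"
  unfolding quadratic_def[abs_def]
  by (intro smooth_on_scaleR smooth_on_const smooth_fst smooth_snd open_W)

lemma homogeneous_quadratic: "homogeneous_on 2 U quadratic"
  unfolding homogeneous_on_def quadratic_def
  using linear_scale[OF linear_left] linear_scale[OF linear_right] by (simp add: power2_eq_square)

lemma D_quadratic:
  assumes z: "z \<in> W"
  shows "D quadratic z v = (1 / 2) *\<^sub>R D (\<lambda>x. \<Gamma> x (snd z) (snd z)) (fst z) (fst v)
    + \<Gamma> (fst z) (snd z) (snd v)"
proof -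
  have "D quadratic z v = (1 / 2) *\<^sub>R D (\<lambda>z. \<Gamma> (fst z) (snd z) (snd z)) z v"
    unfolding quadratic_def[abs_def]
    by (rule D_bounded_linear[OF bounded_linear_scaleR_right smooth_fst[OF smooth_snd smooth_snd] z])
  moreover have "\<Gamma> (fst z) (snd v) (snd z) = \<Gamma> (fst z) (snd z) (snd v)"
    using z symmetric by auto
  ultimately show ?thesis
    unfolding D_fst[OF smooth_snd smooth_snd z] D_snd
    by (simp add: scaleR_right_distrib flip: scaleR_left_distrib)
qed

lemma Dy_quadratic:
  assumes "z \<in> W" shows "D quadratic z (0, u) = \<Gamma> (fst z) (snd z) u"
proof -
  have "linear (D (\<lambda>x. \<Gamma> x (snd z) (snd z)) (fst z))"
    using assms by (intro smooth_on_linear_D[OF smooth_family]) auto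
  then show ?thesis by (simp add: D_quadratic[OF assms] linear_0)
qed

lemma DyDyDy_quadratic:
  assumes z: "z \<in> W"
  shows "D (\<lambda>w. D (\<lambda>w. D quadratic w (0, u)) w (0, v)) z (0, v') = 0"
proof -
  have 1: "D (\<lambda>w. D quadratic w (0, u)) w (0, v) = \<Gamma> (fst w) u v" if w: "w \<in> W" for w
  proof -
    have "D (\<lambda>w. D quadratic w (0, u)) w (0, v) = D (\<lambda>w. \<Gamma> (fst w) (snd w) u) w (0, v)"
      by (rule fun_cong[OF D_cong[OF open_W w]]) (rule Dy_quadratic)
    moreover have "linear (D (\<lambda>x. \<Gamma> x (snd w) u) (fst w))" "\<Gamma> (fst w) v u = \<Gamma> (fst w) u v"
      using w symmetric smooth_on_linear_D[OF smooth_family] by auto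
    moreover have "linear (\<Gamma> (fst w) (snd w))" using w by (auto intro: linear_right)
    ultimately show ?thesis
      by (simp add: D_fst[OF smooth_snd smooth_on_const w] D_snd linear_0)
  qed
  have "D (\<lambda>w. D (\<lambda>w. D quadratic w (0, u)) w (0, v)) z (0, v') = D (\<lambda>w. \<Gamma> (fst w) u v) z (0, v')"
    by (rule fun_cong[OF D_cong[OF open_W z 1]])
  moreover have "linear (D (\<lambda>x. \<Gamma> x u v) (fst z))" "linear (\<Gamma> (fst z) u)"
    using z smooth_on_linear_D[OF smooth_family] linear_right by auto
  ultimately show ?thesis
    using D_fst_right[OF smooth_on_const[of _ v] z, of u "(0, v')"] by (simp add: linear_0)
qed

end

text \<open>For the spray of a linear connection the Jacobi endomorphism is the curvature \<open>R(u, y) y\<close>; flatness is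
the symmetry in \<open>u\<close>, \<open>v\<close> of \<open>\<partial>\<^sub>u \<Gamma>(v, w) + \<Gamma>(u, \<Gamma>(v, w))\<close>.\<close>
lemma jacobi_quadratic_flat:
  fixes \<Gamma> :: "real^'n \<Rightarrow> real^'n \<Rightarrow> real^'n \<Rightarrow> real^'n"
  assumes "symmetric_bilinear_family U \<Gamma>"
    and flat: "\<And>x u v w. x \<in> U \<Longrightarrow> D (\<lambda>x. \<Gamma> x v w) x u + \<Gamma> x u (\<Gamma> x v w)
      = D (\<lambda>x. \<Gamma> x u w) x v + \<Gamma> x v (\<Gamma> x u w)"
    and z: "z \<in> U \<times> - {0}"
  shows "jacobi (symmetric_bilinear_family.quadratic \<Gamma>) z u = 0"
proof -
  interpret symmetric_bilinear_family U \<Gamma> by fact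
  obtain x y where xy: "z = (x, y)" "x \<in> U" "y \<noteq> 0" using z by auto
  have "D (\<lambda>w. D quadratic w (0, u)) z v = D (\<lambda>x. \<Gamma> x y u) x (fst v) + \<Gamma> x (snd v) u" for v
  proof -
    have "D (\<lambda>w. D quadratic w (0, u)) z v = D (\<lambda>w. \<Gamma> (fst w) (snd w) u) z v"
      by (rule fun_cong[OF D_cong[OF open_W z]]) (rule Dy_quadratic)
    then show ?thesis
      unfolding D_fst[OF smooth_snd smooth_on_const z] D_snd
      using linear_0[OF linear_right[OF xy(2), of y]] by (simp add: xy(1))
  qed
  moreover have "\<Gamma> x (- (2 *\<^sub>R quadratic z)) u = - \<Gamma> x u (\<Gamma> x y y)"
    using symmetric[OF xy(2)] linear_neg[OF linear_left[OF xy(2)]] by (simp add: quadratic_def xy)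
  moreover have "\<Gamma> x y 0 = 0" by (rule linear_0[OF linear_right[OF xy(2)]])
  moreover have "D (\<lambda>x. \<Gamma> x y y) x 0 = 0"
    by (rule linear_0[OF smooth_on_linear_D[OF smooth_family xy(2)]])
  moreover have "D (\<lambda>x. \<Gamma> x u y) x = D (\<lambda>x. \<Gamma> x y u) x"
    by (rule D_cong[OF open_U xy(2) symmetric])
  moreover have "\<Gamma> x u y = \<Gamma> x y u" by (rule symmetric[OF xy(2)])
  ultimately show ?thesis
    using flat[OF xy(2), of y y u]
    unfolding jacobi_def Dy_quadratic[OF z] D_quadratic[OF z]
    by (simp add: xy algebra_simps)
qed

context finsler_coordinates
begin

text \<open>The divergence of \<open>P y\<close> is \<open>(n + 1) P\<close>, so \<open>P\<close> cancels in the function whose third fibre derivatives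
form the Douglas tensor. The remainder is the quadratic form of the symmetric bilinear form \<open>B\<close> below,
where \<open>t\<close> is the trace of the connection divided by \<open>n + 1\<close>.\<close>
lemma douglas_eq_0:
  fixes \<Gamma> :: "real^'n \<Rightarrow> real^'n \<Rightarrow> real^'n \<Rightarrow> real^'n"
  assumes \<Gamma>: "symmetric_bilinear_family U \<Gamma>" and P: "smooth_on W P" "homogeneous_on 1 U P"
    and spray: "\<And>w. w \<in> W \<Longrightarrow>
      spray_vec F w = symmetric_bilinear_family.quadratic \<Gamma> w + P w *\<^sub>R snd w"
    and z: "z \<in> W"
  shows "douglas F h i j k z = 0"
proof -
  interpret G: symmetric_bilinear_family U \<Gamma> by fact
  let ?n = "real CARD('n) + 1"
  define t where "t x u = (\<Sum>m\<in>UNIV. \<Gamma> x u (axis m 1) $ m) / ?n" for x u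
  define B where "B x u v = \<Gamma> x u v $ h - (u $ h * t x v + v $ h * t x u)" for x u v
  have t_lin: "linear (t x)" if "x \<in> U" for x
    unfolding t_def using linear_add[OF G.linear_left[OF that]] linear_scale[OF G.linear_left[OF that]]
    by (intro linearI) (simp_all add: sum.distrib add_divide_distrib sum_distrib_left)
  interpret B: symmetric_bilinear_family U B
  proof (rule symmetric_bilinear_family.intro)
    show "smooth_on U (\<lambda>x. B x u v)" for u v
      unfolding B_def t_def divide_inverse
      by (intro smooth_on_diff smooth_on_add smooth_on_mult smooth_on_const smooth_on_sum
          smooth_on_nth G.smooth_family open_U)
    show "linear (B x u)" if "x \<in> U" for x u
      unfolding B_def
      using linear_add[OF G.linear_right[OF that]] linear_scale[OF G.linear_right[OF that]]
        linear_add[OF t_lin[OF that]] linear_scale[OF t_lin[OF that]]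
      by (intro linearI) (simp_all add: algebra_simps)
    show "B x u v = B x v u" if "x \<in> U" for x u v
      using G.symmetric[OF that] by (simp add: B_def algebra_simps)
  qed (rule open_U)
  have eq: "spray F h w - snd w $ h * (\<Sum>m\<in>UNIV. pd_y m (spray F m) w) / ?n = B.quadratic w"
    if w: "w \<in> W" for w
  proof -
    obtain x y where xy: "w = (x, y)" "x \<in> U" "y \<noteq> 0" using w by auto
    have "pd_y m (spray F m) w = \<Gamma> x y (axis m 1) $ m + (P w + D P w (0, axis m 1) * y $ m)" for m
    proof -
      have "D (spray_vec F) w = D (\<lambda>w. G.quadratic w + P w *\<^sub>R snd w) w"
        by (rule D_cong[OF open_W w spray])
      note this D_add[OF G.smooth_quadratic smooth_on_scaleR[OF P(1) G.smooth_snd open_W] w]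
        D_scaleR[OF P(1) G.smooth_snd w] G.Dy_quadratic[OF w] G.D_snd
      then have "D (spray_vec F) w (0, axis m 1) = \<Gamma> x y (axis m 1)
          + (P w *\<^sub>R axis m 1 + D P w (0, axis m 1) *\<^sub>R y)"
        by (simp add: xy(1))
      then show ?thesis by (simp add: pd_y_def D_spray[OF w])
    qed
    moreover have "(\<Sum>m\<in>UNIV. D P w (0, axis m 1) * y $ m) = P w"
      using linear_sum_axis_y[OF smooth_on_linear_D[OF P(1) w], of y] euler_homogeneous[OF P xy(2,3)]
      by (simp add: mult.commute xy(1))
    moreover have n: "?n \<noteq> 0" by linarith
    then have "(\<Sum>m\<in>UNIV. \<Gamma> x y (axis m 1) $ m) = ?n * t x y" by (simp add: t_def)
    ultimately have "(\<Sum>m\<in>UNIV. pd_y m (spray F m) w) = ?n * (t x y + P w)"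
      by (simp add: sum.distrib algebra_simps)
    with n have "snd w $ h * (\<Sum>m\<in>UNIV. pd_y m (spray F m) w) / ?n = y $ h * (t x y + P w)"
      by (simp add: xy(1))
    moreover have "spray F h w = \<Gamma> x y y $ h / 2 + P w * y $ h"
      using spray[OF w] by (simp add: spray_eq_spray_vec G.quadratic_def xy(1))
    moreover have "B.quadratic w = \<Gamma> x y y $ h / 2 - y $ h * t x y"
      by (simp add: B.quadratic_def B_def xy(1))
    ultimately show ?thesis by (simp add: algebra_simps)
  qed
  have 1: "D (\<lambda>z. spray F h z - snd z $ h * (\<Sum>m\<in>UNIV. pd_y m (spray F m) z) / ?n) w = D B.quadratic w"
    if "w \<in> W" for w by (rule D_cong[OF open_W that eq])
  have 2: "D (\<lambda>w. D (\<lambda>z. spray F h z - snd z $ h * (\<Sum>m\<in>UNIV. pd_y m (spray F m) z) / ?n) w u) w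
      = D (\<lambda>w. D B.quadratic w u) w" if "w \<in> W" for w u
    by (rule D_cong[OF open_W that]) (simp add: 1)
  have 3: "D (\<lambda>w. D (\<lambda>w. D (\<lambda>z. spray F h z - snd z $ h * (\<Sum>m\<in>UNIV. pd_y m (spray F m) z) / ?n) w u) w v) z
      = D (\<lambda>w. D (\<lambda>w. D B.quadratic w u) w v) z" for u v
    by (rule D_cong[OF open_W z]) (simp add: 2)
  show ?thesis
    unfolding douglas_def pd_y_def[of i, abs_def] pd_y_def[of j, abs_def] pd_y_def[of k, abs_def]
    by (simp add: 3 B.DyDyDy_quadratic[OF z])
qed

lemma weyl_douglas_eq_0:
  fixes \<Gamma> :: "real^'n \<Rightarrow> real^'n \<Rightarrow> real^'n \<Rightarrow> real^'n"
  assumes \<Gamma>: "symmetric_bilinear_family U \<Gamma>"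
    and flat: "\<And>x u v w. x \<in> U \<Longrightarrow> D (\<lambda>x. \<Gamma> x v w) x u + \<Gamma> x u (\<Gamma> x v w)
      = D (\<lambda>x. \<Gamma> x u w) x v + \<Gamma> x v (\<Gamma> x u w)"
    and projective: "\<And>w. w \<in> W \<Longrightarrow> \<exists>p. spray_vec F w
      = symmetric_bilinear_family.quadratic \<Gamma> w + p *\<^sub>R snd w"
    and z: "z \<in> W"
  shows "weyl_torsion F h i j z = 0" "douglas F h i j k z = 0"
proof -
  interpret G: symmetric_bilinear_family U \<Gamma> by fact
  \<comment> \<open>The factor \<open>p\<close> is recovered by projecting onto \<open>y\<close>, which shows that it is smooth and homogeneous.\<close>
  define P where "P w = ((spray_vec F w - G.quadratic w) \<bullet> snd w) / (snd w \<bullet> snd w)" for w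
  have P1: "smooth_on W P"
    unfolding P_def[abs_def]
    by (intro smooth_on_divide smooth_on_inner smooth_on_diff smooth_spray G.smooth_quadratic
        G.smooth_snd open_W) auto
  have P2: "homogeneous_on 1 U P"
    unfolding homogeneous_on_def P_def
    using homogeneous_onD[OF homogeneous_spray] homogeneous_onD[OF G.homogeneous_quadratic]
    by (simp add: power2_eq_square flip: scaleR_right_diff_distrib)
  have spray: "spray_vec F w = G.quadratic w + P w *\<^sub>R snd w" if w: "w \<in> W" for w
  proof -
    obtain p where p: "spray_vec F w = G.quadratic w + p *\<^sub>R snd w" using projective[OF w] by auto
    moreover have "snd w \<bullet> snd w \<noteq> 0" using w by auto
    ultimately have "P w = p" by (simp add: P_def)
    then show ?thesis using p by simp
  qed
  show "weyl_torsion F h i j z = 0"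
    by (rule weyl_torsion_eq_0[OF G.smooth_quadratic G.homogeneous_quadratic P1 P2 spray
          jacobi_quadratic_flat[OF \<Gamma> flat] z])
  show "douglas F h i j k z = 0"
    by (rule douglas_eq_0[OF \<Gamma> P1 P2 spray z])
qed

end

section \<open>Flat connections from coordinate changes\<close>

locale coordinate_change =
  fixes U V :: "(real^'n::finite) set" and \<psi> \<theta> :: "real^'n \<Rightarrow> real^'n"
  assumes open_U: "open U" and open_V: "open V"
    and smooth_\<psi>: "smooth_on U \<psi>" and smooth_\<theta>: "smooth_on V \<theta>"
    and \<psi>_in: "\<And>x. x \<in> U \<Longrightarrow> \<psi> x \<in> V" and \<theta>_in: "\<And>x. x \<in> V \<Longrightarrow> \<theta> x \<in> U"
    and \<theta>_\<psi>: "\<And>x. x \<in> U \<Longrightarrow> \<theta> (\<psi> x) = x" and \<psi>_\<theta>: "\<And>x. x \<in> V \<Longrightarrow> \<psi> (\<theta> x) = x"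
begin

lemma D\<theta>_D\<psi>:
  assumes x: "x \<in> U" shows "D \<theta> (\<psi> x) (D \<psi> x v) = v"
proof -
  have "D (\<lambda>x. \<theta> (\<psi> x)) x = D (\<lambda>x. x) x" by (rule D_cong[OF open_U x \<theta>_\<psi>])
  then show ?thesis using D_compose[OF smooth_\<psi> x smooth_\<theta> \<psi>_in[OF x], of v] by simp
qed

lemma D\<psi>_D\<theta>:
  assumes x: "x \<in> U" shows "D \<psi> x (D \<theta> (\<psi> x) v) = v"
proof -
  have "D (\<lambda>X. \<psi> (\<theta> X)) (\<psi> x) = D (\<lambda>x. x) (\<psi> x)" by (rule D_cong[OF open_V \<psi>_in[OF x] \<psi>_\<theta>])
  then show ?thesis
    using D_compose[OF smooth_\<theta> \<psi>_in[OF x] smooth_\<psi>, of v] x by (simp add: \<theta>_\<psi>)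
qed

lemma D\<psi>_eq_iff: "x \<in> U \<Longrightarrow> D \<psi> x u = D \<psi> x v \<longleftrightarrow> u = v"
  by (metis D\<theta>_D\<psi>)

text \<open>The Christoffel symbols, in the coordinates \<open>x\<close>, of the connection that is trivial in the coordinates \<open>\<psi> x\<close>.\<close>
definition pulled_back_connection :: "real^'n \<Rightarrow> real^'n \<Rightarrow> real^'n \<Rightarrow> real^'n" where
  "pulled_back_connection x u v = D \<theta> (\<psi> x) (D (\<lambda>x. D \<psi> x u) x v)"

abbreviation "\<Gamma> \<equiv> pulled_back_connection"

lemma D\<psi>_connection: "x \<in> U \<Longrightarrow> D \<psi> x (\<Gamma> x u v) = D (\<lambda>x. D \<psi> x u) x v"
  by (simp add: pulled_back_connection_def D\<psi>_D\<theta>)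

lemma linear_D\<psi>: "x \<in> U \<Longrightarrow> linear (D \<psi> x)"
  by (rule smooth_on_linear_D[OF smooth_\<psi>])

lemma linear_D\<theta>: "x \<in> U \<Longrightarrow> linear (D \<theta> (\<psi> x))"
  by (rule smooth_on_linear_D[OF smooth_\<theta> \<psi>_in])

lemma smooth_connection: "smooth_on U (\<lambda>x. \<Gamma> x u v)"
  unfolding pulled_back_connection_def
  by (rule smooth_on_linear_family[of U "\<lambda>x. D \<theta> (\<psi> x)", OF _ linear_D\<theta>
        smooth_on_D[OF smooth_on_D[OF smooth_\<psi>]] open_U])
     (use smooth_on_compose[OF smooth_\<psi> smooth_on_D[OF smooth_\<theta>]] \<psi>_in open_U in blast)

lemma symmetric_connection: "symmetric_bilinear_family U \<Gamma>"
proof (rule symmetric_bilinear_family.intro)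
  show "linear (\<Gamma> x u)" if "x \<in> U" for x u
    using linear_compose[OF smooth_on_linear_D[OF smooth_on_D[OF smooth_\<psi>] that] linear_D\<theta>[OF that]]
    by (simp add: pulled_back_connection_def[abs_def] o_def)
  show "\<Gamma> x u v = \<Gamma> x v u" if "x \<in> U" for x u v
    unfolding pulled_back_connection_def D_D_commute[OF smooth_\<psi> open_U that, of u v] ..
qed (rule open_U smooth_connection)+

sublocale symmetric_bilinear_family U pulled_back_connection
  by (rule symmetric_connection)

text \<open>Differentiating \<open>D\<psi> \<Gamma>(v, w) = D\<^sup>2\<psi>(v, w)\<close> in direction \<open>u\<close> shows that \<open>D\<psi>\<close> maps either side to the third
derivative \<open>D\<^sup>3\<psi>(u, v, w)\<close>.\<close>
lemma flat_connection:
  assumes x: "x \<in> U"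
  shows "D (\<lambda>x. \<Gamma> x v w) x u + \<Gamma> x u (\<Gamma> x v w) = D (\<lambda>x. \<Gamma> x u w) x v + \<Gamma> x v (\<Gamma> x u w)"
proof -
  have *: "D \<psi> x (D (\<lambda>x. \<Gamma> x v w) x u + \<Gamma> x u (\<Gamma> x v w)) = D (\<lambda>x. D (\<lambda>x. D \<psi> x w) x v) x u" for u v
  proof -
    have "D (\<lambda>x. D (\<lambda>x. D \<psi> x w) x v) x u = D (\<lambda>x. D \<psi> x (\<Gamma> x v w)) x u"
      by (rule fun_cong[OF D_cong[OF open_U x]])
         (simp add: D\<psi>_connection D_D_commute[OF smooth_\<psi> open_U])
    also have "\<dots> = D (\<lambda>y. D \<psi> y (\<Gamma> x v w)) x u + D \<psi> x (D (\<lambda>x. \<Gamma> x v w) x u)"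
      by (rule D_linear_family[of U "D \<psi>", OF smooth_on_D[OF smooth_\<psi>] linear_D\<psi> smooth_connection open_U x])
    also have "D (\<lambda>y. D \<psi> y (\<Gamma> x v w)) x u = D \<psi> x (\<Gamma> x u (\<Gamma> x v w))"
      using D\<psi>_connection[OF x] symmetric[OF x] by metis
    finally show ?thesis using linear_add[OF linear_D\<psi>[OF x]] by (simp add: add.commute)
  qed
  have "D \<psi> x (D (\<lambda>x. \<Gamma> x v w) x u + \<Gamma> x u (\<Gamma> x v w))
      = D \<psi> x (D (\<lambda>x. \<Gamma> x u w) x v + \<Gamma> x v (\<Gamma> x u w))"
    unfolding * by (rule D_D_commute[OF smooth_on_D[OF smooth_\<psi>] open_U x])
  then show ?thesis by (simp add: D\<psi>_eq_iff[OF x])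
qed

text \<open>Here \<open>F\<close> depends only on the fibre coordinate \<open>Y = D\<psi> y\<close> of the coordinates \<open>\<psi> x\<close>. The derivative of \<open>Y\<close>
along \<open>(y, - \<Gamma>(y, y))\<close> is \<open>D\<^sup>2\<psi>(y, y) - D\<psi> \<Gamma>(y, y) = 0\<close>. So both sides of the Euler-Lagrange equation
reduce to the differential of \<open>H\<^sup>2\<close> at \<open>Y\<close>, applied to \<open>D\<^sup>2\<psi>(y, e\<^sub>l)\<close> in one or the other order.\<close>
lemma spray_eq_quadratic:
  assumes F: "finsler_coordinates U F" and H: "smooth_on (- {0}) H"
    and FH: "\<And>z. z \<in> W \<Longrightarrow> F z = H (D \<psi> (fst z) (snd z))"
    and z: "z \<in> W"
  shows "spray_vec F z = quadratic z"
proof (rule finsler_coordinates.spray_vec_unique[OF F z])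
  fix l
  obtain x y where xy: "z = (x, y)" "x \<in> U" "y \<noteq> 0" using z by auto
  let ?h = "\<lambda>Y. (H Y)\<^sup>2"
  let ?K = "\<lambda>w. D \<psi> (fst w) (snd w)"
  have h: "smooth_on (- {0}) ?h"
    using smooth_on_mult[OF H H] by (simp add: power2_eq_square open_Compl)
  have fst: "smooth_on W fst" by (rule smooth_on_fst[OF smooth_on_id[OF open_W] open_W])
  have D\<psi>_fst: "smooth_on W (\<lambda>w. D \<psi> (fst w) u)" for u
    by (rule smooth_on_compose[OF fst smooth_on_D[OF smooth_\<psi>]]) (auto intro: open_W)
  have D_D\<psi>_fst: "D (\<lambda>w. D \<psi> (fst w) u) w v = D (\<lambda>x. D \<psi> x u) (fst w) (fst v)" if "w \<in> W" for w u v
    using D_compose[OF fst that smooth_on_D[OF smooth_\<psi>], of u v] D_linear[OF bounded_linear_fst, of w v] that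
    by auto
  have K: "smooth_on W ?K"
    by (rule smooth_on_linear_family[of W "\<lambda>w. D \<psi> (fst w)", OF D\<psi>_fst _ smooth_snd open_W])
       (auto intro: linear_D\<psi>)
  have DK: "D ?K w v = D (\<lambda>x. D \<psi> x (snd w)) (fst w) (fst v) + D \<psi> (fst w) (snd v)" if w: "w \<in> W" for w v
  proof -
    have "linear (D \<psi> (fst w))" if "w \<in> W" for w using that by (auto intro: linear_D\<psi>)
    from D_linear_family[of W "\<lambda>w. D \<psi> (fst w)", OF D\<psi>_fst this smooth_snd open_W w, of v]
    show ?thesis by (simp add: D_D\<psi>_fst[OF w] D_snd)
  qed
  have K0: "?K w \<in> - {0}" if "w \<in> W" for w
    using that D\<psi>_eq_iff[of "fst w" "snd w" 0] linear_0[OF linear_D\<psi>] by auto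
  have E: "D (\<lambda>w. (F w)\<^sup>2) w v = D ?h (?K w) (D ?K w v)" if w: "w \<in> W" for w v
  proof -
    have "D (\<lambda>w. (F w)\<^sup>2) w = D (\<lambda>w. ?h (?K w)) w"
      by (rule D_cong[OF open_W w]) (simp add: FH)
    then show ?thesis using D_compose[OF K w h K0[OF w]] by simp
  qed
  let ?e = "axis l 1 :: real^'n"
  let ?S = "(snd z, - 2 *\<^sub>R quadratic z)"
  have Ey: "D (\<lambda>w. (F w)\<^sup>2) w (0, ?e) = D ?h (?K w) (D \<psi> (fst w) ?e)" if w: "w \<in> W" for w
  proof -
    have "linear (D (\<lambda>x. D \<psi> x (snd w)) (fst w))"
      using w smooth_on_linear_D[OF smooth_on_D[OF smooth_\<psi>]] by auto
    then show ?thesis by (simp add: E[OF w] DK[OF w] linear_0)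
  qed
  have "D ?K z ?S = 0"
  proof -
    have "- 2 *\<^sub>R quadratic z = - \<Gamma> x y y" by (simp add: quadratic_def xy)
    then show ?thesis
      unfolding DK[OF z] using D\<psi>_connection[OF xy(2)] linear_neg[OF linear_D\<psi>[OF xy(2)]]
      by (simp add: xy)
  qed
  moreover have "D (\<lambda>w. D ?h (?K w) c) z v = D (\<lambda>Y. D ?h Y c) (?K z) (D ?K z v)" for c v
    by (rule D_compose[OF K z smooth_on_D[OF h] K0[OF z]])
  moreover have "D (\<lambda>w. D (\<lambda>w. (F w)\<^sup>2) w (0, ?e)) z = D (\<lambda>w. D ?h (?K w) (D \<psi> (fst w) ?e)) z"
    by (rule D_cong[OF open_W z Ey])
  moreover have "D (\<lambda>w. D ?h (?K w) (D \<psi> (fst w) ?e)) z v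
      = D (\<lambda>w. D ?h (?K w) (D \<psi> (fst z) ?e)) z v + D ?h (?K z) (D (\<lambda>w. D \<psi> (fst w) ?e) z v)" for v
  proof (rule D_linear_family[of W "\<lambda>w. D ?h (?K w)", OF _ _ D\<psi>_fst open_W z])
    show "smooth_on W (\<lambda>w. D ?h (?K w) u)" for u
      by (rule smooth_on_compose[OF K smooth_on_D[OF h] image_subsetI[OF K0] open_W])
    show "linear (D ?h (?K w))" if "w \<in> W" for w
      by (rule smooth_on_linear_D[OF h K0[OF that]])
  qed
  moreover have "linear (D (\<lambda>Y. D ?h Y c) (?K z))" for c
    by (rule smooth_on_linear_D[OF smooth_on_D[OF h] K0[OF z]])
  moreover have "D (\<lambda>w. D \<psi> (fst w) ?e) z ?S = D (\<lambda>x. D \<psi> x ?e) x y"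
    using D_D\<psi>_fst[OF z, of ?e ?S] by (simp add: xy(1))
  ultimately have "D (\<lambda>w. D (\<lambda>w. (F w)\<^sup>2) w (0, ?e)) z ?S = D ?h (?K z) (D (\<lambda>x. D \<psi> x ?e) x y)"
    by (simp add: linear_0 xy)
  moreover have "D (\<lambda>w. (F w)\<^sup>2) z (?e, 0) = D ?h (?K z) (D (\<lambda>x. D \<psi> x y) x ?e)"
    unfolding E[OF z] DK[OF z] using linear_0[OF linear_D\<psi>[OF xy(2)]] by (simp add: xy)
  ultimately show "D (\<lambda>w. D (\<lambda>w. (F w)\<^sup>2) w (0, ?e)) z ?S = D (\<lambda>w. (F w)\<^sup>2) z (?e, 0)"
    using D_D_commute[OF smooth_\<psi> open_U xy(2)] by metis
qed

text \<open>The left side of the geodesic equation of the flat connection transforms as a vector; in the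
coordinates \<open>\<psi> x\<close> it is the plain acceleration.\<close>
lemma acceleration_change:
  fixes x :: "real \<Rightarrow> real^'n"
  assumes J: "open J" "t \<in> J" and x: "smooth_on J x" "x ` J \<subseteq> U"
  shows "D (\<lambda>s. \<psi> (x s)) t 1 = D \<psi> (x t) (D x t 1)"
    and "D (\<lambda>s. D (\<lambda>s. \<psi> (x s)) s 1) t 1
      = D \<psi> (x t) (D (\<lambda>s. D x s 1) t 1 + 2 *\<^sub>R quadratic (x t, D x t 1))"
proof -
  have xU: "x s \<in> U" if "s \<in> J" for s using that x by auto
  have 1: "D (\<lambda>s. \<psi> (x s)) s 1 = D \<psi> (x s) (D x s 1)" if "s \<in> J" for s
    by (rule D_compose[OF x(1) that smooth_\<psi> xU[OF that]])
  show "D (\<lambda>s. \<psi> (x s)) t 1 = D \<psi> (x t) (D x t 1)" by (rule 1[OF J(2)])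
  have "D (\<lambda>s. D (\<lambda>s. \<psi> (x s)) s 1) t 1 = D (\<lambda>s. D \<psi> (x s) (D x s 1)) t 1"
    by (rule fun_cong[OF D_cong[OF J 1]])
  also have "\<dots> = D (\<lambda>s. D \<psi> (x s) (D x t 1)) t 1 + D \<psi> (x t) (D (\<lambda>s. D x s 1) t 1)"
    by (rule D_linear_family[of J "\<lambda>s. D \<psi> (x s)", OF smooth_on_compose[OF x(1) smooth_on_D[OF smooth_\<psi>] x(2) J(1)]
          linear_D\<psi>[OF xU] smooth_on_D[OF x(1)] J])
  also have "D (\<lambda>s. D \<psi> (x s) (D x t 1)) t 1 = D (\<lambda>z. D \<psi> z (D x t 1)) (x t) (D x t 1)"
    by (rule D_compose[OF x(1) J(2) smooth_on_D[OF smooth_\<psi>] xU[OF J(2)]])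
  also have "\<dots> = D \<psi> (x t) (2 *\<^sub>R quadratic (x t, D x t 1))"
    by (simp add: quadratic_def D\<psi>_connection[OF xU[OF J(2)]])
  finally show "D (\<lambda>s. D (\<lambda>s. \<psi> (x s)) s 1) t 1
      = D \<psi> (x t) (D (\<lambda>s. D x s 1) t 1 + 2 *\<^sub>R quadratic (x t, D x t 1))"
    using linear_add[OF linear_D\<psi>[OF xU[OF J(2)]]] by (simp add: add.commute)
qed

end

section \<open>Charts and geodesics\<close>

definition overlap :: "('m, 'n) chart \<Rightarrow> ('m, 'n) chart \<Rightarrow> (real^'n) set" where
  "overlap c d = chart_map c ` (chart_dom c \<inter> chart_dom d)"

definition transition :: "('m, 'n) chart \<Rightarrow> ('m, 'n) chart \<Rightarrow> real^'n \<Rightarrow> real^'n" where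
  "transition c d = chart_map d \<circ> chart_inv c"

lemma chart_inv_map:
  assumes "is_chart c" "p \<in> chart_dom c" shows "chart_inv c (chart_map c p) = p"
  using assms unfolding is_chart_def homeomorphism_def by blast

lemma chart_map_inv:
  assumes "is_chart c" "x \<in> chart_img c" shows "chart_map c (chart_inv c x) = x"
  using assms unfolding is_chart_def homeomorphism_def by blast

lemma chart_inv_in:
  assumes "is_chart c" "x \<in> chart_img c" shows "chart_inv c x \<in> chart_dom c"
  using assms unfolding is_chart_def homeomorphism_def by blast

lemma chart_map_in: "p \<in> chart_dom c \<Longrightarrow> chart_map c p \<in> chart_img c"
  by (simp add: chart_img_def)

lemma overlap_iff:
  assumes "is_chart c"
  shows "x \<in> overlap c d \<longleftrightarrow> x \<in> chart_img c \<and> chart_inv c x \<in> chart_dom d"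
  using assms chart_inv_map[OF assms] chart_map_inv[OF assms] chart_inv_in[OF assms]
  unfolding overlap_def chart_img_def by (smt (verit) Int_iff image_iff)

lemma open_overlap:
  assumes c: "is_chart c" and d: "is_chart d" shows "open (overlap c d)"
proof -
  have "overlap c d = chart_img c \<inter> chart_inv c -` chart_dom d"
    using overlap_iff[OF c] by blast
  moreover have "continuous_on (chart_img c) (chart_inv c)" "open (chart_img c)"
    using c by (auto simp: is_chart_def homeomorphism_def)
  moreover have "open (chart_dom d)" using d by (simp add: is_chart_def)
  ultimately show ?thesis by (simp add: continuous_open_preimage)
qed

locale atlas =
  fixes A :: "('m::{t2_space, second_countable_topology}, 'n::finite) chart set"
  assumes manifold: "smooth_manifold A"
begin

lemma chart: "c \<in> A \<Longrightarrow> is_chart c"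
  using manifold by (simp add: smooth_manifold_def)

lemma coordinate_change_transition:
  assumes c: "c \<in> A" and d: "d \<in> A"
  shows "coordinate_change (overlap c d) (overlap d c) (transition c d) (transition d c)"
proof
  show "open (overlap c d)" "open (overlap d c)"
    using open_overlap chart c d by blast+
  show "smooth_on (overlap c d) (transition c d)"
    using manifold c d unfolding smooth_manifold_def smooth_transition_def overlap_def transition_def by blast
  show "smooth_on (overlap d c) (transition d c)"
    using manifold c d unfolding smooth_manifold_def smooth_transition_def overlap_def transition_def by blast
qed (use chart_inv_map[OF chart[OF c]] chart_inv_map[OF chart[OF d]] in \<open>auto simp: overlap_def transition_def\<close>)

text \<open>A tangent vector is a derivation, so the transformation law of its components is the chain rule for
\<open>f \<circ> chart_inv d\<close> composed with the transition map.\<close>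
lemma coord_expr_transition:
  assumes c: "c \<in> A" and d: "d \<in> A" and x: "x \<in> overlap c d"
  shows "coord_expr A c K (x, y) = coord_expr A d K (transition c d x, D (transition c d) x y)"
proof -
  interpret coordinate_change "overlap c d" "overlap d c" "transition c d" "transition d c"
    by (rule coordinate_change_transition[OF c d])
  have inv: "chart_inv c x = chart_inv d (transition c d x)" if "x \<in> overlap c d" for x
    using that chart_inv_map[OF chart[OF d]] overlap_iff[OF chart[OF c]] by (simp add: transition_def)
  have img: "transition c d x \<in> chart_img d"
    using x overlap_iff[OF chart[OF c]] chart_map_in by (metis comp_apply transition_def)
  have "tangent_vector A c x y = tangent_vector A d (transition c d x) (D (transition c d) x y)"
  proof
    fix f
    show "tangent_vector A c x y f = tangent_vector A d (transition c d x) (D (transition c d) x y) f"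
    proof (cases "smooth_function A f")
      case True
      then have f: "smooth_on (chart_img d) (f \<circ> chart_inv d)" using d by (simp add: smooth_function_def)
      have "D (f \<circ> chart_inv c) x = D (\<lambda>x. (f \<circ> chart_inv d) (transition c d x)) x"
        by (rule D_cong[OF open_U x]) (simp add: inv)
      then have "D (f \<circ> chart_inv c) x y = D (f \<circ> chart_inv d) (transition c d x) (D (transition c d) x y)"
        using D_compose[OF smooth_\<psi> x f img] by simp
      then show ?thesis using True by (simp add: tangent_vector_def)
    qed (simp add: tangent_vector_def)
  qed
  then show ?thesis using inv[OF x] by (simp add: coord_expr_def)
qed

lemma finsler_coordinates_subset:
  assumes "finsler_space A L" "c \<in> A" "open U" "U \<subseteq> chart_img c"
  shows "finsler_coordinates U (coord_expr A c L)"
proof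
  show "smooth_on (U \<times> - {0}) (coord_expr A c L)"
    by (rule smooth_on_subset[of "chart_img c \<times> - {0}"]) (use assms in \<open>auto simp: finsler_space_def\<close>)
qed (use assms in \<open>auto simp: finsler_space_def\<close>)

text \<open>The velocity is a function on all of the real line, with unspecified values outside \<open>J\<close>; openness
of \<open>J\<close> makes its derivative at \<open>t\<close> independent of them.\<close>
lemma velocity_acceleration_eq_D:
  fixes x :: "real \<Rightarrow> real^'n"
  assumes "open J" "t \<in> J" "smooth_on J x"
  shows "vector_derivative x (at t) = D x t 1"
    and "vector_derivative (\<lambda>s. vector_derivative x (at s)) (at t) = D (\<lambda>s. D x s 1) t 1"
proof -
  have vd: "vector_derivative f (at s) = D f s 1" if "smooth_on J f" "s \<in> J" for f :: "real \<Rightarrow> real^'n" and s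
    using frechet_derivative_eq_vector_derivative[OF smooth_on_differentiable[OF that]] by simp
  show "vector_derivative x (at t) = D x t 1" by (rule vd[OF assms(3,2)])
  have "((\<lambda>s. D x s 1) has_vector_derivative D (\<lambda>s. D x s 1) t 1) (at t)"
    using vd[OF smooth_on_D[OF assms(3)] assms(2)] smooth_on_differentiable[OF smooth_on_D[OF assms(3)] assms(2)]
    by (metis vector_derivative_works)
  then have "((\<lambda>s. vector_derivative x (at s)) has_vector_derivative D (\<lambda>s. D x s 1) t 1) (at t)"
    by (rule has_vector_derivative_transform_within_open[OF _ assms(1,2)]) (simp add: vd[OF assms(3)])
  then show "vector_derivative (\<lambda>s. vector_derivative x (at s)) (at t) = D (\<lambda>s. D x s 1) t 1"
    by (rule vector_derivative_at)
qed

lemma open_curve_preimage: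
  assumes "regular_curve A I \<gamma>" "c \<in> A" shows "open {t \<in> I. \<gamma> t \<in> chart_dom c}"
proof -
  have "{t \<in> I. \<gamma> t \<in> chart_dom c} = I \<inter> \<gamma> -` chart_dom c" by auto
  then show ?thesis
    using assms chart[OF assms(2)] continuous_open_preimage[of I \<gamma> "chart_dom c"]
    by (auto simp: regular_curve_def is_chart_def)
qed

end

text \<open>A chart \<open>d\<close> in which \<open>L\<close> is the function \<open>H\<close> of the fibre coordinate alone.\<close>
locale minkowski_chart = atlas A
  for A :: "('m::{t2_space, second_countable_topology}, 'n::finite) chart set" +
  fixes L :: "'m \<Rightarrow> 'm tangent \<Rightarrow> real" and d :: "('m, 'n) chart" and H :: "real^'n \<Rightarrow> real"
  assumes finsler: "finsler_space A L" and d: "d \<in> A"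
    and H: "\<And>x y. x \<in> chart_img d \<Longrightarrow> coord_expr A d L (x, y) = H y"
begin

lemma smooth_H:
  assumes "chart_img d \<noteq> {}" shows "smooth_on (- {0}) H"
proof -
  obtain X where X: "X \<in> chart_img d" using assms by auto
  have o: "open (- {0 :: real^'n})" by (simp add: open_Compl)
  have "smooth_on (- {0}) (\<lambda>Y. coord_expr A d L (X, Y))"
    by (rule smooth_on_compose[where T="chart_img d \<times> - {0}"])
       (use finsler d X o in \<open>auto simp: finsler_space_def intro!: smooth_on_Pair smooth_on_const smooth_on_id\<close>)
  then show ?thesis using H[OF X] by simp
qed

lemma spray_eq:
  assumes c: "c \<in> A" and x: "x \<in> overlap c d" "y \<noteq> 0"
  shows "spray_vec (coord_expr A c L) (x, y) = coordinate_change.pulled_back_connection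
    (transition c d) (transition d c) x y y /\<^sub>R 2"
proof -
  interpret coordinate_change "overlap c d" "overlap d c" "transition c d" "transition d c"
    by (rule coordinate_change_transition[OF c d])
  have img: "transition c d x \<in> chart_img d" if "x \<in> overlap c d" for x
    using that overlap_iff[OF chart[OF c]] chart_map_in by (metis comp_apply transition_def)
  have F: "finsler_coordinates (overlap c d) (coord_expr A c L)"
    by (rule finsler_coordinates_subset[OF finsler c open_U]) (auto simp: overlap_iff[OF chart[OF c]])
  have "chart_img d \<noteq> {}" using img x by auto
  from spray_eq_quadratic[OF F smooth_H[OF this], of "(x, y)"] show ?thesis
    using x by (auto simp: coord_expr_transition[OF c d] H img quadratic_def)
qed

text \<open>The geodesic equation in any chart \<open>c\<close> is the same condition on the Minkowski coordinates \<open>X\<close> of the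
curve, with the same factor \<open>w\<close>. This is what allows one \<open>w\<close> to serve for all charts at once.\<close>
lemma geodesic_equation_transition:
  assumes \<gamma>: "regular_curve A I \<gamma>" and c: "c \<in> A"
    and t: "t \<in> I" "\<gamma> t \<in> chart_dom c" "\<gamma> t \<in> chart_dom d"
  defines "x \<equiv> chart_map c \<circ> \<gamma>" and "X \<equiv> chart_map d \<circ> \<gamma>"
  shows "vector_derivative X (at t) = D (transition c d) (x t) (vector_derivative x (at t))"
    and "vector_derivative (\<lambda>s. vector_derivative x (at s)) (at t)
      + 2 *\<^sub>R spray_vec (coord_expr A c L) (x t, vector_derivative x (at t)) = w *\<^sub>R vector_derivative x (at t)
    \<longleftrightarrow> vector_derivative (\<lambda>s. vector_derivative X (at s)) (at t) = w *\<^sub>R vector_derivative X (at t)"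
proof -
  interpret coordinate_change "overlap c d" "overlap d c" "transition c d" "transition d c"
    by (rule coordinate_change_transition[OF c d])
  define J where "J = {t \<in> I. \<gamma> t \<in> chart_dom c} \<inter> {t \<in> I. \<gamma> t \<in> chart_dom d}"
  have J: "open J" "t \<in> J"
    unfolding J_def using open_curve_preimage[OF \<gamma> c] open_curve_preimage[OF \<gamma> d] t by auto
  have x: "smooth_on J x" and X: "smooth_on J X"
    using \<gamma> c d smooth_on_subset[of "{t \<in> I. \<gamma> t \<in> chart_dom c}" x J]
      smooth_on_subset[of "{t \<in> I. \<gamma> t \<in> chart_dom d}" X J]
    by (auto simp: regular_curve_def J_def x_def X_def)
  have xU: "x ` J \<subseteq> overlap c d" by (auto simp: J_def x_def overlap_def)
  have Xx: "X s = transition c d (x s)" if "s \<in> J" for s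
    using that chart_inv_map[OF chart[OF c]] by (auto simp: J_def x_def X_def transition_def)
  have DX: "D X s = D (\<lambda>s. transition c d (x s)) s" if "s \<in> J" for s
    by (rule D_cong[OF J(1) that Xx])
  have DDX: "D (\<lambda>s. D X s 1) t = D (\<lambda>s. D (\<lambda>s. transition c d (x s)) s 1) t"
    by (rule D_cong[OF J]) (simp add: DX)
  note eqs = velocity_acceleration_eq_D[OF J x] velocity_acceleration_eq_D[OF J X]
  have xt: "x t \<in> overlap c d" using xU J by auto
  have y: "D x t 1 \<noteq> 0"
    using \<gamma> c t eqs(1) by (auto simp: regular_curve_def x_def)
  show "vector_derivative X (at t) = D (transition c d) (x t) (vector_derivative x (at t))"
    unfolding eqs DX[OF J(2)] by (rule acceleration_change(1)[OF J x xU])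
  show "vector_derivative (\<lambda>s. vector_derivative x (at s)) (at t)
      + 2 *\<^sub>R spray_vec (coord_expr A c L) (x t, vector_derivative x (at t)) = w *\<^sub>R vector_derivative x (at t)
    \<longleftrightarrow> vector_derivative (\<lambda>s. vector_derivative X (at s)) (at t) = w *\<^sub>R vector_derivative X (at t)"
    unfolding eqs DX[OF J(2)] DDX acceleration_change[OF J x xU]
    using D\<psi>_eq_iff[OF xt, of _ "w *\<^sub>R D x t 1"] linear_scale[OF linear_D\<psi>[OF xt]]
    by (simp add: spray_eq[OF c xt y] quadratic_def)
qed

lemma geodesic_iff_straight:
  assumes \<gamma>: "regular_curve A I \<gamma>" and dom: "\<gamma> ` I \<subseteq> chart_dom d"
  defines "X \<equiv> chart_map d \<circ> \<gamma>"
  shows "geodesic A L I \<gamma> \<longleftrightarrow> (\<exists>w. \<forall>t\<in>I.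
    vector_derivative (\<lambda>s. vector_derivative X (at s)) (at t) = w t *\<^sub>R vector_derivative X (at t))"
proof -
  have "(\<forall>c\<in>A. \<forall>t\<in>I. \<gamma> t \<in> chart_dom c \<longrightarrow>
        (let x = chart_map c \<circ> \<gamma>; y = (\<lambda>s. vector_derivative x (at s))
         in vector_derivative y (at t) + 2 *\<^sub>R (\<chi> i. spray (coord_expr A c L) i (x t, y t)) = w t *\<^sub>R y t))
    \<longleftrightarrow> (\<forall>t\<in>I. vector_derivative (\<lambda>s. vector_derivative X (at s)) (at t) = w t *\<^sub>R vector_derivative X (at t))" for w
    using geodesic_equation_transition(2)[OF \<gamma>] dom d
    unfolding Let_def spray_vec_def X_def by (smt (verit, best) image_subset_iff)
  then show ?thesis using \<gamma> by (simp add: geodesic_def)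
qed

end

section \<open>Geodesics of Minkowskian spaces are straight lines\<close>

lemma orthogonal_test_parallel:
  fixes u z :: "'a::real_inner"
  assumes "\<And>a. u \<bullet> a = 0 \<Longrightarrow> z \<bullet> a = 0" shows "\<exists>c. z = c *\<^sub>R u"
proof -
  \<comment> \<open>The component of \<open>z\<close> orthogonal to \<open>u\<close>; for \<open>u = 0\<close> division by zero makes it \<open>z\<close> itself.\<close>
  define a where "a = z - ((z \<bullet> u) / (u \<bullet> u)) *\<^sub>R u"
  have "u \<bullet> a = 0" by (cases "u = 0") (simp_all add: a_def inner_diff_right inner_commute)
  then have "a \<bullet> a = 0" using assms[of a] by (simp add: a_def inner_diff_left[of z] inner_commute)
  then show ?thesis by (auto simp: a_def)
qed

lemma D_eq_0_imp_constant:
  fixes f :: "real \<Rightarrow> real"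
  assumes I: "is_interval I" and f: "smooth_on I f" and D: "\<And>t. t \<in> I \<Longrightarrow> D f t 1 = 0"
    and st: "s \<in> I" "t \<in> I"
  shows "f s = f t"
proof -
  have "(f has_derivative (\<lambda>h. 0)) (at r within I)" if "r \<in> I" for r
  proof -
    have "D f r h = 0" for h
      using linear_scale[OF smooth_on_linear_D[OF f that], of h 1] D[OF that] by simp
    then have "D f r = (\<lambda>h. 0)" by auto
    then show ?thesis
      using smooth_on_has_derivative[OF f that] has_derivative_at_withinI by metis
  qed
  then obtain c where "\<And>x. x \<in> I \<Longrightarrow> f x = c"
    using has_derivative_zero_constant[of I f] I by (auto simp: is_interval_convex)
  then show ?thesis using st by simp
qed

text \<open>If \<open>v' = w v\<close> then for each vector \<open>a\<close> the quotient \<open>(v \<bullet> a)\<^sup>2 / (v \<bullet> v)\<close> has derivative zero. Hence the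
vectors orthogonal to \<open>v\<close> do not depend on the time, and \<open>v\<close> keeps its direction. Working with this
quotient needs no regularity of \<open>w\<close>. Conversely, on a line the velocity and the acceleration are
both orthogonal to everything that is orthogonal to the line.\<close>
lemma parallel_acceleration_iff_collinear:
  fixes X :: "real \<Rightarrow> 'a::euclidean_space"
  assumes I: "open I" "is_interval I" and X: "smooth_on I X" and v: "\<And>t. t \<in> I \<Longrightarrow> D X t 1 \<noteq> 0"
  shows "(\<exists>w. \<forall>t\<in>I. D (\<lambda>s. D X s 1) t 1 = w t *\<^sub>R D X t 1) \<longleftrightarrow> collinear (X ` I)"
proof
  let ?v = "\<lambda>t. D X t 1"
  note sv = smooth_on_D[OF X, of 1]
  have inner: "smooth_on I (\<lambda>t. f t \<bullet> a)" "t \<in> I \<Longrightarrow> D (\<lambda>t. f t \<bullet> a) t 1 = D f t 1 \<bullet> a"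
    if "smooth_on I f" for f :: "real \<Rightarrow> 'a" and a t
    using smooth_on_bounded_linear[OF bounded_linear_inner_left that I(1)]
      D_bounded_linear[OF bounded_linear_inner_left that] by auto
  {
    assume "\<exists>w. \<forall>t\<in>I. D ?v t 1 = w t *\<^sub>R ?v t"
    then obtain w where w: "\<And>t. t \<in> I \<Longrightarrow> D ?v t 1 = w t *\<^sub>R ?v t" by auto
    show "collinear (X ` I)"
    proof (cases "I = {}")
      case False
      then obtain t0 where t0: "t0 \<in> I" by auto
      have orth: "?v t \<bullet> a = 0" if a: "?v t0 \<bullet> a = 0" and t: "t \<in> I" for a t
      proof -
        define N where "N = (\<lambda>t. ?v t \<bullet> ?v t)"
        define q where "q = (\<lambda>t. ?v t \<bullet> a)"
        have N0: "N t \<noteq> 0" if "t \<in> I" for t using v[OF that] by (simp add: N_def)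
        have N: "smooth_on I N" unfolding N_def by (rule smooth_on_inner[OF sv sv I(1)])
        have DN: "D N t 1 = 2 * w t * N t" if "t \<in> I" for t
          unfolding N_def using D_bounded_bilinear[OF bounded_bilinear_inner sv sv that, of 1] w[OF that] by simp
        have q: "smooth_on I q" unfolding q_def by (rule inner(1)[OF sv])
        have Dq: "D q t 1 = w t * q t" if "t \<in> I" for t
          unfolding q_def using inner(2)[OF sv that] w[OF that] by simp
        have "D (\<lambda>t. q t * q t / N t) t 1 = 0" if t: "t \<in> I" for t
        proof -
          have "((\<lambda>t. q t * q t / N t) has_derivative
              (\<lambda>h. (((q t * D q t h + D q t h * q t) * N t - q t * q t * D N t h) / (N t * N t)))) (at t)"
            by (rule has_derivative_divide'[OF has_derivative_mult[OF smooth_on_has_derivative[OF q t]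
                  smooth_on_has_derivative[OF q t]] smooth_on_has_derivative[OF N t] N0[OF t]])
          from D_eqI[OF this] show ?thesis by (simp add: DN[OF t] Dq[OF t])
        qed
        moreover have "smooth_on I (\<lambda>t. q t * q t / N t)"
          by (intro smooth_on_divide smooth_on_mult q N N0 I(1))
        ultimately have "q t * q t / N t = q t0 * q t0 / N t0"
          using D_eq_0_imp_constant[OF I(2)] t t0 by blast
        then show ?thesis using a N0[OF t] by (simp add: q_def)
      qed
      have par: "\<exists>c. X t - X t0 = c *\<^sub>R ?v t0" if t: "t \<in> I" for t
      proof (rule orthogonal_test_parallel)
        fix a assume "?v t0 \<bullet> a = 0"
        then have "X t \<bullet> a = X t0 \<bullet> a"
          using D_eq_0_imp_constant[OF I(2) inner(1)[OF X] _ t t0] inner(2)[OF X] orth by simp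
        then show "(X t - X t0) \<bullet> a = 0" by (simp add: inner_diff_left)
      qed
      show ?thesis
        unfolding collinear_def
      proof (intro exI[of _ "?v t0"] ballI)
        fix x y assume "x \<in> X ` I" "y \<in> X ` I"
        then obtain s t where "s \<in> I" "x = X s" "t \<in> I" "y = X t" by auto
        then obtain c c' where "x - X t0 = c *\<^sub>R ?v t0" "y - X t0 = c' *\<^sub>R ?v t0" using par by metis
        then have "x - y = (c - c') *\<^sub>R ?v t0" by (simp add: algebra_simps)
        then show "\<exists>c. x - y = c *\<^sub>R ?v t0" ..
      qed
    qed (simp)
  }
  {
    assume "collinear (X ` I)"
    then obtain u where u: "\<And>s t. s \<in> I \<Longrightarrow> t \<in> I \<Longrightarrow> \<exists>c. X s - X t = c *\<^sub>R u"
      unfolding collinear_def by blast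
    have 0: "?v t \<bullet> a = 0" if "u \<bullet> a = 0" "t \<in> I" for a t
    proof -
      have "X s \<bullet> a = X t \<bullet> a" if s: "s \<in> I" for s
      proof -
        obtain c where "X s - X t = c *\<^sub>R u" using u[OF s \<open>t \<in> I\<close>] ..
        then have "(X s - X t) \<bullet> a = 0" using \<open>u \<bullet> a = 0\<close> by simp
        then show ?thesis by (simp add: inner_diff_left)
      qed
      then have "D (\<lambda>s. X s \<bullet> a) t = D (\<lambda>s. X t \<bullet> a) t" by (rule D_cong[OF I(1) that(2)])
      then show ?thesis using inner(2)[OF X that(2), of a] by simp
    qed
    have 1: "D ?v t 1 \<bullet> a = 0" if "u \<bullet> a = 0" "t \<in> I" for a t
    proof -
      have "D (\<lambda>s. ?v s \<bullet> a) t = D (\<lambda>s. 0) t" by (rule D_cong[OF I(1) that(2)]) (rule 0[OF that(1)])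
      then show ?thesis using inner(2)[OF sv that(2), of a] by simp
    qed
    have "\<exists>w. D ?v t 1 = w *\<^sub>R ?v t" if t: "t \<in> I" for t
    proof -
      obtain c where c: "?v t = c *\<^sub>R u" using orthogonal_test_parallel[of u "?v t"] 0 t by blast
      obtain c' where c': "D ?v t 1 = c' *\<^sub>R u" using orthogonal_test_parallel[of u "D ?v t 1"] 1 t by blast
      have "c \<noteq> 0" using v[OF t] c by auto
      then have "D ?v t 1 = (c' / c) *\<^sub>R ?v t" by (simp add: c c')
      then show ?thesis ..
    qed
    then show "\<exists>w. \<forall>t\<in>I. D ?v t 1 = w t *\<^sub>R ?v t" by metis
  }
qed

context minkowski_chart
begin

lemma geodesic_iff_collinear:
  assumes \<gamma>: "regular_curve A I \<gamma>" and dom: "\<gamma> ` I \<subseteq> chart_dom d"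
  shows "geodesic A L I \<gamma> \<longleftrightarrow> collinear ((chart_map d \<circ> \<gamma>) ` I)"
proof -
  let ?X = "chart_map d \<circ> \<gamma>"
  have I: "open I" "is_interval I" using \<gamma> by (auto simp: regular_curve_def)
  have "{t \<in> I. \<gamma> t \<in> chart_dom d} = I" using dom by auto
  moreover have "smooth_on {t \<in> I. \<gamma> t \<in> chart_dom d} ?X"
    using \<gamma> d unfolding regular_curve_def by blast
  ultimately have X: "smooth_on I ?X" by simp
  have v: "vector_derivative ?X (at t) \<noteq> 0" if "t \<in> I" for t
    using \<gamma> d dom that unfolding regular_curve_def by blast
  note eqs = velocity_acceleration_eq_D[OF I(1) _ X]
  have "(\<exists>w. \<forall>t\<in>I. vector_derivative (\<lambda>s. vector_derivative ?X (at s)) (at t) = w t *\<^sub>R vector_derivative ?X (at t))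
    \<longleftrightarrow> (\<exists>w. \<forall>t\<in>I. D (\<lambda>s. D ?X s 1) t 1 = w t *\<^sub>R D ?X t 1)"
    using eqs by simp
  also have "\<dots> \<longleftrightarrow> collinear (?X ` I)"
    by (rule parallel_acceleration_iff_collinear[OF I X]) (use v eqs(1) in simp)
  finally show ?thesis using geodesic_iff_straight[OF \<gamma> dom] by simp
qed

text \<open>A short segment of a straight line in Minkowski coordinates is a regular curve in every chart,
because transition maps have injective differentials, and it is a geodesic since it is collinear.\<close>
lemma straight_line_geodesic:
  assumes X0: "X0 \<in> chart_img d" and Y: "Y \<noteq> 0"
  obtains I where "0 \<in> I" "geodesic A L I (\<lambda>t. chart_inv d (X0 + t *\<^sub>R Y))"
    "\<And>t. t \<in> I \<Longrightarrow> X0 + t *\<^sub>R Y \<in> chart_img d"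
proof -
  let ?l = "\<lambda>t. X0 + t *\<^sub>R Y"
  let ?\<gamma> = "\<lambda>t. chart_inv d (?l t)"
  have l: "continuous_on S ?l" for S by (intro continuous_intros)
  have "open (?l -` chart_img d)"
    using chart[OF d] by (intro open_vimage l) (simp add: is_chart_def)
  then obtain e where e: "e > 0" "ball 0 e \<subseteq> ?l -` chart_img d"
    using X0 open_contains_ball[of "?l -` chart_img d"] by force
  define I :: "real set" where "I = ball 0 e"
  have I: "open I" "is_interval I" "0 \<in> I"
    using e(1) by (simp_all add: I_def is_interval_convex_1)
  have img: "?l t \<in> chart_img d" if "t \<in> I" for t using that e(2) by (auto simp: I_def)
  have dom: "?\<gamma> ` I \<subseteq> chart_dom d" using img chart_inv_in[OF chart[OF d]] by blast
  have cont: "continuous_on I ?\<gamma>"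
    by (rule continuous_on_compose2[of "chart_img d" "chart_inv d"])
       (use chart[OF d] l img in \<open>auto simp: is_chart_def homeomorphism_def\<close>)
  have sl: "smooth_on S ?l" if "open S" for S
    by (intro smooth_on_add smooth_on_scaleR smooth_on_const smooth_on_id that)
  have Dl: "D ?l t 1 = Y" for t
  proof -
    have "(?l has_derivative (\<lambda>h. h *\<^sub>R Y)) (at t)" by (auto intro!: derivative_eq_intros)
    from D_eqI[OF this] show ?thesis by simp
  qed
  have \<gamma>: "regular_curve A I ?\<gamma>"
    unfolding regular_curve_def
  proof (intro conjI ballI I(1,2) cont impI)
    fix c assume c: "c \<in> A"
    interpret coordinate_change "overlap d c" "overlap c d" "transition d c" "transition c d"
      by (rule coordinate_change_transition[OF d c])
    let ?J = "{t \<in> I. ?\<gamma> t \<in> chart_dom c}"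
    have "?J = I \<inter> ?\<gamma> -` chart_dom c" by auto
    then have J: "open ?J"
      using continuous_open_preimage[OF cont I(1), of "chart_dom c"] chart[OF c] by (simp add: is_chart_def)
    have ov: "?l t \<in> overlap d c" if "t \<in> ?J" for t
      using that img overlap_iff[OF chart[OF d]] by blast
    have eq: "chart_map c \<circ> ?\<gamma> = (\<lambda>t. transition d c (?l t))"
      by (simp add: transition_def o_def)
    show sm: "smooth_on ?J (chart_map c \<circ> ?\<gamma>)"
      unfolding eq by (rule smooth_on_compose[OF sl[OF J] smooth_\<psi> image_subsetI[OF ov] J])
    fix t assume "t \<in> I" "?\<gamma> t \<in> chart_dom c"
    then have t: "t \<in> ?J" by simp
    have "D (chart_map c \<circ> ?\<gamma>) t 1 = D (transition d c) (?l t) Y"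
      unfolding eq D_compose[OF sl[OF J] t smooth_\<psi> ov[OF t]] Dl ..
    then show "vector_derivative (chart_map c \<circ> ?\<gamma>) (at t) \<noteq> 0"
      using velocity_acceleration_eq_D(1)[OF J t sm] D\<psi>_eq_iff[OF ov[OF t], of Y 0]
        linear_0[OF linear_D\<psi>[OF ov[OF t]]] Y by simp
  qed
  have "collinear ((chart_map d \<circ> ?\<gamma>) ` I)"
    unfolding collinear_def
  proof (intro exI[of _ Y] ballI)
    fix x y assume "x \<in> (chart_map d \<circ> ?\<gamma>) ` I" "y \<in> (chart_map d \<circ> ?\<gamma>) ` I"
    then obtain s t where "x = ?l s" "y = ?l t"
      using img chart_map_inv[OF chart[OF d]] by auto
    then have "x - y = (s - t) *\<^sub>R Y" by (simp add: algebra_simps)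
    then show "\<exists>c. x - y = c *\<^sub>R Y" ..
  qed
  then have "geodesic A L I ?\<gamma>" by (simp add: geodesic_iff_collinear[OF \<gamma> dom])
  then show ?thesis using that I(3) img by blast
qed

text \<open>The straight line with velocity \<open>y\<close> at \<open>x\<close> is a geodesic of both spaces. Its acceleration at \<open>x\<close> is
common to the two geodesic equations, so their difference leaves a multiple of \<open>y\<close>.\<close>
lemma projective_spray_difference:
  assumes projective: "projectively_related A L L'" and c: "c \<in> A"
    and x: "x \<in> overlap c d" and y: "y \<noteq> 0"
  shows "\<exists>p. spray_vec (coord_expr A c L') (x, y) = spray_vec (coord_expr A c L) (x, y) + p *\<^sub>R y"
proof -
  interpret coordinate_change "overlap c d" "overlap d c" "transition c d" "transition d c"
    by (rule coordinate_change_transition[OF c d])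
  define X0 where "X0 = transition c d x"
  define Y where "Y = D (transition c d) x y"
  have Y: "Y \<noteq> 0" using D\<psi>_eq_iff[OF x, of y 0] linear_0[OF linear_D\<psi>[OF x]] y by (simp add: Y_def)
  have cx: "x \<in> chart_img c" "chart_inv c x \<in> chart_dom d"
    using x overlap_iff[OF chart[OF c]] by blast+
  have X0: "X0 \<in> chart_img d" using chart_map_in[OF cx(2)] by (simp add: X0_def transition_def)
  have inv: "chart_inv d X0 = chart_inv c x"
    using chart_inv_map[OF chart[OF d] cx(2)] by (simp add: X0_def transition_def)
  define \<gamma> where "\<gamma> = (\<lambda>t. chart_inv d (X0 + t *\<^sub>R Y))"
  obtain I where I: "0 \<in> I" "geodesic A L I \<gamma>" "\<And>t. t \<in> I \<Longrightarrow> X0 + t *\<^sub>R Y \<in> chart_img d"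
    using straight_line_geodesic[OF X0 Y] unfolding \<gamma>_def by metis
  have I': "geodesic A L' I \<gamma>" using projective I(2) by (simp add: projectively_related_def)
  have \<gamma>: "regular_curve A I \<gamma>" using I(2) by (simp add: geodesic_def)
  have \<gamma>0: "\<gamma> 0 = chart_inv c x" "\<gamma> 0 \<in> chart_dom c" "\<gamma> 0 \<in> chart_dom d"
    using inv chart_inv_in[OF chart[OF c] cx(1)] cx(2) by (simp_all add: \<gamma>_def)
  let ?x = "chart_map c \<circ> \<gamma>"
  have x0: "?x 0 = x" using \<gamma>0(1) chart_map_inv[OF chart[OF c] cx(1)] by simp
  have "vector_derivative (chart_map d \<circ> \<gamma>) (at 0) = Y"
  proof (rule vector_derivative_at, rule has_vector_derivative_transform_within_open[where S=I])
    show "((\<lambda>t. X0 + t *\<^sub>R Y) has_vector_derivative Y) (at 0)"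
      by (auto intro!: derivative_eq_intros)
    show "open I" using \<gamma> by (simp add: regular_curve_def)
  qed (use I chart_map_inv[OF chart[OF d]] in \<open>auto simp: \<gamma>_def\<close>)
  then have "D (transition c d) x (vector_derivative ?x (at 0)) = D (transition c d) x y"
    using geodesic_equation_transition(1)[OF \<gamma> c I(1) \<gamma>0(2,3)] x0 by (simp add: Y_def)
  then have v: "vector_derivative ?x (at 0) = y" by (simp add: D\<psi>_eq_iff[OF x])
  have eq: "\<exists>w. vector_derivative (\<lambda>s. vector_derivative ?x (at s)) (at 0)
      + 2 *\<^sub>R spray_vec (coord_expr A c K) (x, y) = w *\<^sub>R y" if K: "geodesic A K I \<gamma>" for K
  proof -
    obtain w where "\<forall>c\<in>A. \<forall>t\<in>I. \<gamma> t \<in> chart_dom c \<longrightarrow>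
        vector_derivative (\<lambda>s. vector_derivative (chart_map c \<circ> \<gamma>) (at s)) (at t)
        + 2 *\<^sub>R spray_vec (coord_expr A c K)
            ((chart_map c \<circ> \<gamma>) t, vector_derivative (chart_map c \<circ> \<gamma>) (at t))
        = w t *\<^sub>R vector_derivative (chart_map c \<circ> \<gamma>) (at t)"
      using K unfolding geodesic_def Let_def spray_vec_def by blast
    from bspec[OF bspec[OF this c] I(1)] show ?thesis
      using \<gamma>0(2) unfolding v x0 by blast
  qed
  obtain w w' where
    "vector_derivative (\<lambda>s. vector_derivative ?x (at s)) (at 0)
      + 2 *\<^sub>R spray_vec (coord_expr A c L) (x, y) = w *\<^sub>R y"
    "vector_derivative (\<lambda>s. vector_derivative ?x (at s)) (at 0)
      + 2 *\<^sub>R spray_vec (coord_expr A c L') (x, y) = w' *\<^sub>R y"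
    using eq[OF I(2)] eq[OF I'] by auto
  then have "2 *\<^sub>R spray_vec (coord_expr A c L') (x, y) - 2 *\<^sub>R spray_vec (coord_expr A c L) (x, y)
      = w' *\<^sub>R y - w *\<^sub>R y"
    by (metis add_diff_cancel_left)
  then have "2 *\<^sub>R spray_vec (coord_expr A c L') (x, y)
      = 2 *\<^sub>R spray_vec (coord_expr A c L) (x, y) + (w' - w) *\<^sub>R y"
    by (simp add: algebra_simps)
  then have "2 *\<^sub>R spray_vec (coord_expr A c L') (x, y)
      = 2 *\<^sub>R (spray_vec (coord_expr A c L) (x, y) + ((w' - w) / 2) *\<^sub>R y)"
    by (simp add: scaleR_right_distrib)
  then show ?thesis by (metis scaleR_cancel_left zero_neq_numeral)
qed

lemma weyl_douglas_eq_0: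
  assumes projective: "projectively_related A L L'" and finsler': "finsler_space A L'"
    and c: "c \<in> A" and x: "x \<in> overlap c d" and y: "y \<noteq> 0"
  shows "weyl_torsion (coord_expr A c L') h i j (x, y) = 0"
    and "douglas (coord_expr A c L') h i j k (x, y) = 0"
proof -
  interpret coordinate_change "overlap c d" "overlap d c" "transition c d" "transition d c"
    by (rule coordinate_change_transition[OF c d])
  interpret F: finsler_coordinates "overlap c d" "coord_expr A c L'"
    by (rule finsler_coordinates_subset[OF finsler' c open_U]) (use overlap_iff[OF chart[OF c]] in blast)
  have "\<exists>p. spray_vec (coord_expr A c L') w = quadratic w + p *\<^sub>R snd w" if "w \<in> W" for w
  proof -
    obtain a b where "w = (a, b)" "a \<in> overlap c d" "b \<noteq> 0" using \<open>w \<in> W\<close> by auto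
    then show ?thesis
      using projective_spray_difference[OF projective c, of a b] spray_eq[OF c, of a b]
      by (simp add: quadratic_def)
  qed
  note F.weyl_douglas_eq_0[OF symmetric_connection flat_connection this, of "(x, y)"]
  then show "weyl_torsion (coord_expr A c L') h i j (x, y) = 0"
    "douglas (coord_expr A c L') h i j k (x, y) = 0" using x y by auto
qed

end

theorem theorem5p5:
  fixes A :: "('m::{t2_space, second_countable_topology}, 'n::finite) chart set"
    and L Lbar \<beta> :: "'m \<Rightarrow> 'm tangent \<Rightarrow> real"
    and \<sigma> :: "'m \<Rightarrow> real"
    and C :: "(real \<times> real) set"
    and f :: "real \<times> real \<Rightarrow> real"
  assumes manifold: "smooth_manifold A"
    and finsler: "finsler_space A L"
    and change: "gen_beta_conformal_change A \<sigma> \<beta> C f L Lbar"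
    and finsler_bar: "finsler_space A Lbar"
    and projective: "projectively_related A L Lbar"
    and minkowski: "minkowskian A L"
  shows "(\<forall>c\<in>A. \<forall>x\<in>chart_img c. \<forall>y.
            y \<noteq> 0 \<and> m_covector (coord_expr A c L) (coord_expr A c \<beta>) (x, y) \<noteq> 0 \<longrightarrow>
              (\<forall>h i j. weyl_torsion (coord_expr A c Lbar) h i j (x, y) = 0) \<and>
              (\<forall>h i j k. douglas (coord_expr A c Lbar) h i j k (x, y) = 0))
         \<and> (CARD('n) > 2 \<longrightarrow> projectively_flat A L)"
proof -
  interpret atlas A by unfold_locales (rule manifold)
  have mink: "\<exists>d H. p \<in> chart_dom d \<and> minkowski_chart A L d H" for p
  proof -
    obtain d H where "d \<in> A" "p \<in> chart_dom d" "\<forall>x\<in>chart_img d. \<forall>y. coord_expr A d L (x, y) = H y"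
      using minkowski unfolding minkowskian_def by metis
    then have "minkowski_chart A L d H" by unfold_locales (use finsler in auto)
    then show ?thesis using \<open>p \<in> chart_dom d\<close> by blast
  qed
  have "weyl_torsion (coord_expr A c Lbar) h i j (x, y) = 0 \<and> douglas (coord_expr A c Lbar) h i j k (x, y) = 0"
    if c: "c \<in> A" and x: "x \<in> chart_img c" and y: "y \<noteq> 0" for c x y h i j k
  proof -
    obtain d H where d: "chart_inv c x \<in> chart_dom d" "minkowski_chart A L d H" using mink by blast
    have "x \<in> overlap c d" using overlap_iff[OF chart[OF c]] x d(1) by blast
    from minkowski_chart.weyl_douglas_eq_0[OF d(2) projective finsler_bar c this y]
    show ?thesis by blast
  qed
  moreover have "projectively_flat A L"
    unfolding projectively_flat_def
  proof
    fix p
    obtain d H where p: "p \<in> chart_dom d" and mc: "minkowski_chart A L d H" using mink by blast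
    interpret minkowski_chart A L d H by (rule mc)
    show "\<exists>c\<in>A. p \<in> chart_dom c \<and> (\<forall>I \<gamma>. regular_curve A I \<gamma> \<and> \<gamma> ` I \<subseteq> chart_dom c \<longrightarrow>
        (geodesic A L I \<gamma> \<longleftrightarrow> collinear ((chart_map c \<circ> \<gamma>) ` I)))"
      using p d geodesic_iff_collinear by blast
  qed
  ultimately show ?thesis by blast
qed

end
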